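(* Let $V$ be an $\mathrm{FI}_G$-module over a commutative ring $k$ which is generated in degree $\le d$ and has first homological degree $hd_1(V)\le r$ (with $d,r$ non-negative integers). Then $$\mathrm{reg}(V)\le r+\min\{r,d\}-1,$$ i.e. $hd_i(V)\le i+r+\min\{r,d\}-1$ for all $i\ge 1$.
   Context: Fix a commutative ring $k$ and a group $G$. $\mathrm{FI}_G$ is the category with objects $[n]=\{1,\dots,n\}$ ($n\ge 0$, $[0]=\emptyset$) and morphisms $[n]\to[m]$ the pairs $(f,g)$ with $f:[n]\to[m]$ injective and $g:[n]\to G$ a map of sets; composition is $(f,g)\circ(f',g')=(f\circ f',h)$ with $h(x)=g'(x)\,g(f'(x))$. Write $G_n=\mathfrak S_n\wr G=\mathrm{Aut}_{\mathrm{FI}_G}([n])$. An $\mathrm{FI}_G$-module is a functor $V:\mathrm{FI}_G\to\mathrm{Mod}_k$, $V_n:=V([n])$; these form an abelian category with kernels and cokernels computed pointwise. An $\mathrm{FB}_G$-module is a sequence $(W_n)_{n\ge0}$ with $W_n$ a $k[G_n]$-module (regarded as an $\mathrm{FI}_G$-module in which all maps $[n]\to[m]$, $n<m$, act by zero). For a $k[G_n]$-module $W$, $M(W)$ is the $\mathrm{FI}_G$-module with $M(W)_m=W\otimes_{k[G_n]}k[\mathrm{Hom}_{\mathrm{FI}_G}([n],[m])]$, morphisms acting by postcomposition on the second factor; $M(n):=M(k[G_n])$. $\deg V=\sup\{n:V_n\ne0\}$ (with $\sup\emptyset=-\infty$). $H_0(V)$ is the $\mathrm{FB}_G$-module $H_0(V)_n=V_n/V_{<n}$,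 where $V_{<n}$ is the $k$-span of the images of all $V(f,g)$ for morphisms $(f,g):[m]\to[n]$ with $m<n$; $H_0$ is right exact and $H_i$ denotes its $i$-th left derived functor; $hd_i(V):=\deg H_i(V)$. $V$ is generated in degree $\le m$ if there is a surjection $\bigoplus_{i\in I}M(n_i)\to V$ with all $n_i\le m$ (equivalently $hd_0(V)\le m$). The regularity $\mathrm{reg}(V)$ is the smallest $N$ such that $hd_i(V)-i\le N$ for all $i\ge 1$. *)

theory Defs
  imports Complex_Main
begin

text \<open>The group G is modelled as a type 'g of class group_add (written additively,
  not necessarily commutative). A morphism [n] -> [m] of FI_G is a pair (f,g)
  normalised to be 0 outside [n] = {1..n}.\<close>

definition Hom :: "nat \<Rightarrow> nat \<Rightarrow> ((nat \<Rightarrow> nat) \<times> (nat \<Rightarrow> 'g::group_add)) set" where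
  "Hom n m = {(f, g). f ` {1..n} \<subseteq> {1..m} \<and> inj_on f {1..n} \<and>
                      (\<forall>x. x \<notin> {1..n} \<longrightarrow> f x = 0 \<and> g x = 0)}"

definition hom_id :: "nat \<Rightarrow> (nat \<Rightarrow> nat) \<times> (nat \<Rightarrow> 'g::group_add)" where
  "hom_id n = (\<lambda>x. if x \<in> {1..n} then x else 0, \<lambda>x. 0)"

definition hom_comp :: "nat \<Rightarrow> (nat \<Rightarrow> nat) \<times> (nat \<Rightarrow> 'g::group_add)
    \<Rightarrow> (nat \<Rightarrow> nat) \<times> (nat \<Rightarrow> 'g) \<Rightarrow> (nat \<Rightarrow> nat) \<times> (nat \<Rightarrow> 'g)" where
  "hom_comp n \<phi> \<psi> =
     (\<lambda>x. if x \<in> {1..n} then fst \<phi> (fst \<psi> x) else 0,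
      \<lambda>x. if x \<in> {1..n} then snd \<psi> x + snd \<phi> (fst \<psi> x) else 0)"

text \<open>An FI_G-module over k: k-module structure sc on a type 'v, V_n = C n
  (a k-submodule of 'v), and act n m phi : V_n -> V_m for phi in Hom n m.\<close>
definition fig_module ::
  "('k::comm_ring_1 \<Rightarrow> 'v::ab_group_add \<Rightarrow> 'v) \<Rightarrow> (nat \<Rightarrow> 'v set)
   \<Rightarrow> (nat \<Rightarrow> nat \<Rightarrow> (nat \<Rightarrow> nat) \<times> (nat \<Rightarrow> 'g::group_add) \<Rightarrow> 'v \<Rightarrow> 'v) \<Rightarrow> bool" where
  "fig_module sc C act \<longleftrightarrow>
     module sc \<and> (\<forall>n. module.subspace sc (C n)) \<and>
     (\<forall>n m \<phi>. \<phi> \<in> Hom n m \<longrightarrow>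
        (\<forall>x\<in>C n. act n m \<phi> x \<in> C m) \<and>
        (\<forall>x\<in>C n. \<forall>y\<in>C n. act n m \<phi> (x + y) = act n m \<phi> x + act n m \<phi> y) \<and>
        (\<forall>c. \<forall>x\<in>C n. act n m \<phi> (sc c x) = sc c (act n m \<phi> x))) \<and>
     (\<forall>n. \<forall>x\<in>C n. act n n (hom_id n) x = x) \<and>
     (\<forall>n m p \<phi> \<psi>. \<phi> \<in> Hom n m \<longrightarrow> \<psi> \<in> Hom m p \<longrightarrow>
        (\<forall>x\<in>C n. act n p (hom_comp n \<psi> \<phi>) x = act m p \<psi> (act n m \<phi> x)))"

definition fig_map ::
  "('k::comm_ring_1 \<Rightarrow> 'v::ab_group_add \<Rightarrow> 'v) \<Rightarrow> (nat \<Rightarrow> 'v set)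
   \<Rightarrow> (nat \<Rightarrow> nat \<Rightarrow> (nat \<Rightarrow> nat) \<times> (nat \<Rightarrow> 'g::group_add) \<Rightarrow> 'v \<Rightarrow> 'v)
   \<Rightarrow> ('k \<Rightarrow> 'w::ab_group_add \<Rightarrow> 'w) \<Rightarrow> (nat \<Rightarrow> 'w set)
   \<Rightarrow> (nat \<Rightarrow> nat \<Rightarrow> (nat \<Rightarrow> nat) \<times> (nat \<Rightarrow> 'g) \<Rightarrow> 'w \<Rightarrow> 'w)
   \<Rightarrow> (nat \<Rightarrow> 'v \<Rightarrow> 'w) \<Rightarrow> bool" where
  "fig_map sc1 C1 act1 sc2 C2 act2 F \<longleftrightarrow>
     (\<forall>n. \<forall>x\<in>C1 n. F n x \<in> C2 n) \<and>
     (\<forall>n. \<forall>x\<in>C1 n. \<forall>y\<in>C1 n. F n (x + y) = F n x + F n y) \<and>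
     (\<forall>n c. \<forall>x\<in>C1 n. F n (sc1 c x) = sc2 c (F n x)) \<and>
     (\<forall>n m \<phi>. \<phi> \<in> Hom n m \<longrightarrow> (\<forall>x\<in>C1 n. F m (act1 n m \<phi> x) = act2 n m \<phi> (F n x)))"

definition lower ::
  "('k::comm_ring_1 \<Rightarrow> 'v::ab_group_add \<Rightarrow> 'v) \<Rightarrow> (nat \<Rightarrow> 'v set)
   \<Rightarrow> (nat \<Rightarrow> nat \<Rightarrow> (nat \<Rightarrow> nat) \<times> (nat \<Rightarrow> 'g::group_add) \<Rightarrow> 'v \<Rightarrow> 'v) \<Rightarrow> nat \<Rightarrow> 'v set" where
  "lower sc C act n = module.span sc (\<Union>m\<in>{..<n}. \<Union>\<phi>\<in>Hom m n. act m n \<phi> ` C m)"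

text \<open>Generated in degree <= d, in the form hd_0(V) <= d, i.e. H_0(V)_n = V_n / V_{<n} = 0 for n > d.\<close>
definition generated_in_degree_le ::
  "('k::comm_ring_1 \<Rightarrow> 'v::ab_group_add \<Rightarrow> 'v) \<Rightarrow> (nat \<Rightarrow> 'v set)
   \<Rightarrow> (nat \<Rightarrow> nat \<Rightarrow> (nat \<Rightarrow> nat) \<times> (nat \<Rightarrow> 'g::group_add) \<Rightarrow> 'v \<Rightarrow> 'v) \<Rightarrow> nat \<Rightarrow> bool" where
  "generated_in_degree_le sc C act d \<longleftrightarrow> (\<forall>n. d < n \<longrightarrow> C n \<subseteq> lower sc C act n)"

text \<open>Free FI_G-module, i.e. isomorphic to a direct sum of M(n_b) = k[Hom([n_b], -)]:
  there is a set B of generators b in degree deg b such that for every m the elements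
  act (deg b) m phi b, for (b, phi) with phi in Hom (deg b) m, are pairwise distinct,
  k-linearly independent and span V_m.\<close>
definition free_fig ::
  "('k::comm_ring_1 \<Rightarrow> 'v::ab_group_add \<Rightarrow> 'v) \<Rightarrow> (nat \<Rightarrow> 'v set)
   \<Rightarrow> (nat \<Rightarrow> nat \<Rightarrow> (nat \<Rightarrow> nat) \<times> (nat \<Rightarrow> 'g::group_add) \<Rightarrow> 'v \<Rightarrow> 'v) \<Rightarrow> bool" where
  "free_fig sc C act \<longleftrightarrow>
     (\<exists>B deg. (\<forall>b\<in>B. b \<in> C (deg b)) \<and>
        (\<forall>m. inj_on (\<lambda>(b, \<phi>). act (deg b) m \<phi> b) {(b, \<phi>). b \<in> B \<and> \<phi> \<in> Hom (deg b) m} \<and>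
             module.independent sc ((\<lambda>(b, \<phi>). act (deg b) m \<phi> b) ` {(b, \<phi>). b \<in> B \<and> \<phi> \<in> Hom (deg b) m}) \<and>
             module.span sc ((\<lambda>(b, \<phi>). act (deg b) m \<phi> b) ` {(b, \<phi>). b \<in> B \<and> \<phi> \<in> Hom (deg b) m}) = C m))"

definition free_resolution ::
  "('k::comm_ring_1 \<Rightarrow> 'v::ab_group_add \<Rightarrow> 'v) \<Rightarrow> (nat \<Rightarrow> 'v set)
   \<Rightarrow> (nat \<Rightarrow> nat \<Rightarrow> (nat \<Rightarrow> nat) \<times> (nat \<Rightarrow> 'g::group_add) \<Rightarrow> 'v \<Rightarrow> 'v)
   \<Rightarrow> ('k \<Rightarrow> 'p::ab_group_add \<Rightarrow> 'p) \<Rightarrow> (nat \<Rightarrow> nat \<Rightarrow> 'p set)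
   \<Rightarrow> (nat \<Rightarrow> nat \<Rightarrow> nat \<Rightarrow> (nat \<Rightarrow> nat) \<times> (nat \<Rightarrow> 'g) \<Rightarrow> 'p \<Rightarrow> 'p)
   \<Rightarrow> (nat \<Rightarrow> nat \<Rightarrow> 'p \<Rightarrow> 'p) \<Rightarrow> (nat \<Rightarrow> 'p \<Rightarrow> 'v) \<Rightarrow> bool" where
  "free_resolution sc C act scP PC Pact dP eps \<longleftrightarrow>
     (\<forall>j. fig_module scP (PC j) (Pact j)) \<and>
     (\<forall>j. free_fig scP (PC j) (Pact j)) \<and>
     fig_map scP (PC 0) (Pact 0) sc C act eps \<and>
     (\<forall>j. fig_map scP (PC (Suc j)) (Pact (Suc j)) scP (PC j) (Pact j) (dP (Suc j))) \<and>
     (\<forall>n. eps n ` PC 0 n = C n) \<and>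
     (\<forall>n. {x \<in> PC 0 n. eps n x = 0} = dP 1 n ` PC 1 n) \<and>
     (\<forall>j n. {x \<in> PC (Suc j) n. dP (Suc j) n x = 0} = dP (Suc (Suc j)) n ` PC (Suc (Suc j)) n)"

text \<open>H_i(V)_n = 0, computed as the i-th homology (in degree n) of the complex H_0(P_*),
  where H_0(P_j)_n = P_j(n) / P_j(n)_{<n}.\<close>
definition H_vanishes ::
  "('k::comm_ring_1 \<Rightarrow> 'p::ab_group_add \<Rightarrow> 'p) \<Rightarrow> (nat \<Rightarrow> nat \<Rightarrow> 'p set)
   \<Rightarrow> (nat \<Rightarrow> nat \<Rightarrow> nat \<Rightarrow> (nat \<Rightarrow> nat) \<times> (nat \<Rightarrow> 'g::group_add) \<Rightarrow> 'p \<Rightarrow> 'p)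
   \<Rightarrow> (nat \<Rightarrow> nat \<Rightarrow> 'p \<Rightarrow> 'p) \<Rightarrow> nat \<Rightarrow> nat \<Rightarrow> bool" where
  "H_vanishes scP PC Pact dP i n \<longleftrightarrow>
     (\<forall>x\<in>PC i n. (i = 0 \<or> dP i n x \<in> lower scP (PC (i - 1)) (Pact (i - 1)) n) \<longrightarrow>
        (\<exists>y\<in>PC (Suc i) n. x - dP (Suc i) n y \<in> lower scP (PC i) (Pact i) n))"

definition hd_le ::
  "('k::comm_ring_1 \<Rightarrow> 'p::ab_group_add \<Rightarrow> 'p) \<Rightarrow> (nat \<Rightarrow> nat \<Rightarrow> 'p set)
   \<Rightarrow> (nat \<Rightarrow> nat \<Rightarrow> nat \<Rightarrow> (nat \<Rightarrow> nat) \<times> (nat \<Rightarrow> 'g::group_add) \<Rightarrow> 'p \<Rightarrow> 'p)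
   \<Rightarrow> (nat \<Rightarrow> nat \<Rightarrow> 'p \<Rightarrow> 'p) \<Rightarrow> nat \<Rightarrow> int \<Rightarrow> bool" where
  "hd_le scP PC Pact dP i N \<longleftrightarrow> (\<forall>n. N < int n \<longrightarrow> H_vanishes scP PC Pact dP i n)"

end

theory Submission
  imports Defs "HOL-Library.Function_Algebras"
begin

text \<open>A choice of order on each finite set reduces everything to face maps and transpositions: the
  homology of \<open>V\<close> in degree \<open>n\<close> is that of the Koszul complex, which has one copy of \<open>V\<close> in degree
  \<open>n - i\<close> for every \<open>i\<close>-element subset of \<open>{1..n}\<close>; free modules are acyclic for it. Splitting the
  subsets of \<open>{1..n + 1}\<close> by whether they contain \<open>n + 1\<close> gives Gan's long exact sequence
  \<open>H_{p-1}(KV)_n \<rightarrow> H_p(V)_{n+1} \<rightarrow> H_p(DV)_n \<rightarrow> H_{p-2}(KV)_n \<rightarrow> H_{p-1}(V)_{n+1}\<close>,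
  where \<open>KV\<close> and \<open>DV\<close> are the kernel and the cokernel of the map from \<open>V\<close> to its shift. Both degree
  bounds drop by one for \<open>DV\<close>, so induction bounds the regularity of \<open>DV\<close>. All morphisms from smaller
  degrees act by zero on \<open>KV\<close>, so \<open>KV = H_0(KV)\<close>; its degree is therefore bounded by \<open>H_2(DV)\<close> and
  \<open>H_1(V)\<close>, and the same sequence then bounds the regularity of \<open>V\<close>.\<close>

section \<open>Koszul complexes\<close>

text \<open>The statement computes homology from an arbitrary free resolution P, so Koszul homology
  has to be reached from there. \<open>V\<close> is replaced by P_0 modulo its syzygy, which keeps
  every derivative inside the type of the resolution. The two homologies need only be compared in
  degree one, for each P_j modulo its syzygy; dimension shifting along P yields the other degrees.
  Labels in \<open>G\<close> are invisible to the complex: a non-surjective morphism factors through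
  a face with label 0, and the other factor takes over its labels. Vanishing does not involve
  scalars either, so the Koszul part works with additive subgroups. The constant comes from a
  balanced recursion. For positive \<open>r\<close>, passing to \<open>DV\<close> lowers
  \<open>r + min r d\<close> by two, and the kernel is controlled by the second homology of
  \<open>DV\<close>, whose degree bound is the regularity bound of \<open>DV\<close> plus two. So
  \<open>KV\<close> is zero above degree \<open>r + min r d - 1\<close>, which is exactly what
  reproduces the bound for \<open>V\<close>. For \<open>r = 0\<close> the bound need not drop: it
  asks for vanishing of \<open>H_i\<close> in degrees at least \<open>i\<close>, and in smaller
  degrees the complex has no chains.\<close>

definition subgrp :: "'a::ab_group_add set \<Rightarrow> bool" where
  "subgrp A \<longleftrightarrow> 0 \<in> A \<and> (\<forall>x\<in>A. \<forall>y\<in>A. x - y \<in> A)"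

lemma subgrpD:
  assumes "subgrp A"
  shows "0 \<in> A" "\<And>x y. x \<in> A \<Longrightarrow> y \<in> A \<Longrightarrow> x - y \<in> A"
    "\<And>x y. x \<in> A \<Longrightarrow> y \<in> A \<Longrightarrow> x + y \<in> A" "\<And>x. x \<in> A \<Longrightarrow> - x \<in> A"
proof -
  show 0: "0 \<in> A" and m: "\<And>x y. x \<in> A \<Longrightarrow> y \<in> A \<Longrightarrow> x - y \<in> A"
    using assms by (auto simp: subgrp_def)
  show n: "- x \<in> A" if "x \<in> A" for x
    using m[OF 0 that] by simp
  show "x + y \<in> A" if "x \<in> A" "y \<in> A" for x y
    using m[OF that(1) n[OF that(2)]] by simp
qed

lemma subgrp_sum:
  assumes "subgrp A" "\<And>j. j \<in> J \<Longrightarrow> f j \<in> A"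
  shows "sum f J \<in> A"
  using assms(2) by (induction J rule: infinite_finite_induct) (auto intro: subgrpD[OF assms(1)])

text \<open>Restriction along adjoining a new last point. Positions are counted from the front, so
  the faces of the shifted module keep their index and only the degree rises.\<close>

definition shift :: "(nat \<Rightarrow> 'b) \<Rightarrow> nat \<Rightarrow> 'b" where
  "shift X m = X (Suc m)"

definition stable :: "(nat \<Rightarrow> nat \<Rightarrow> 'a \<Rightarrow> 'a) \<Rightarrow> (nat \<Rightarrow> 'a::ab_group_add set) \<Rightarrow> bool" where
  "stable \<delta> A \<longleftrightarrow> (\<forall>m. subgrp (A m)) \<and> (\<forall>m j x. j \<le> m \<longrightarrow> x \<in> A m \<longrightarrow> \<delta> m j x \<in> A (Suc m))"

definition additive_on :: "'a::ab_group_add set \<Rightarrow> ('a \<Rightarrow> 'b::ab_group_add) \<Rightarrow> bool" where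
  "additive_on A f \<longleftrightarrow> (\<forall>x\<in>A. \<forall>y\<in>A. f (x + y) = f x + f y)"

lemma additive_onD:
  assumes "subgrp A" "additive_on A f"
  shows "f 0 = 0" "\<And>x y. x \<in> A \<Longrightarrow> y \<in> A \<Longrightarrow> f (x + y) = f x + f y"
    "\<And>x y. x \<in> A \<Longrightarrow> y \<in> A \<Longrightarrow> f (x - y) = f x - f y" "\<And>x. x \<in> A \<Longrightarrow> f (- x) = - f x"
proof -
  show a: "\<And>x y. x \<in> A \<Longrightarrow> y \<in> A \<Longrightarrow> f (x + y) = f x + f y"
    using assms(2) by (auto simp: additive_on_def)
  have "f (0 + 0) = f 0 + f 0" using a subgrpD(1)[OF assms(1)] by blast
  then show 0: "f 0 = 0" by simp
  show n: "f (- x) = - f x" if "x \<in> A" for x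
  proof -
    have "f (x + - x) = f x + f (- x)" using a that subgrpD(4)[OF assms(1)] by blast
    then show ?thesis using 0 by (metis add.right_inverse minus_unique)
  qed
  show "f (x - y) = f x - f y" if "x \<in> A" "y \<in> A" for x y
    using a[OF that(1) subgrpD(4)[OF assms(1) that(2)]] n[OF that(2)] by simp
qed

text \<open>The map \<^term>\<open>\<delta> m j\<close> stands for the order preserving injection of an \<open>m\<close>-set into
  an \<open>m + 1\<close>-set that skips position \<open>j\<close>, where positions are counted from \<open>0\<close>.\<close>

definition face_module :: "(nat \<Rightarrow> nat \<Rightarrow> 'a \<Rightarrow> 'a) \<Rightarrow> (nat \<Rightarrow> 'a::ab_group_add set) \<Rightarrow> bool" where
  "face_module \<delta> C \<longleftrightarrow> stable \<delta> C \<and>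
     (\<forall>m j. j \<le> m \<longrightarrow> additive_on (C m) (\<delta> m j)) \<and>
     (\<forall>m i j x. i \<le> j \<longrightarrow> j \<le> m \<longrightarrow> x \<in> C m \<longrightarrow> \<delta> (Suc m) (Suc j) (\<delta> m i x) = \<delta> (Suc m) i (\<delta> m j x))"

lemma stable_shift: "stable \<delta> A \<Longrightarrow> stable (shift \<delta>) (shift A)"
  by (simp add: stable_def shift_def)

lemma stable_subgrp: "stable \<delta> A \<Longrightarrow> subgrp (A m)"
  by (simp add: stable_def)

lemma face_module_stable: "face_module \<delta> C \<Longrightarrow> stable \<delta> C"
  by (simp add: face_module_def)

lemma face_module_subgrp: "face_module \<delta> C \<Longrightarrow> subgrp (C m)"
  by (simp add: face_module_def stable_def)

lemma face_module_shift: "face_module \<delta> C \<Longrightarrow> face_module (shift \<delta>) (shift C)"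
  by (simp add: face_module_def stable_def shift_def)

section \<open>Chains and the differential, built up one point at a time\<close>

abbreviation nF :: "bool list \<Rightarrow> nat" where "nF l \<equiv> count_list l False"
abbreviation nT :: "bool list \<Rightarrow> nat" where "nT l \<equiv> count_list l True"

text \<open>A list \<open>l\<close> of length \<open>n\<close> encodes the subset of the \<open>n\<close>-set, listed from its last element
  down to its first, at which \<open>l\<close> is \<^term>\<open>True\<close>; the Koszul complex of a module \<open>C\<close> in
  degree \<open>n\<close> has one copy of \<open>C (n - i)\<close> for each subset with \<open>i\<close> elements.\<close>

definition chains :: "(nat \<Rightarrow> 'a::zero set) \<Rightarrow> nat \<Rightarrow> int \<Rightarrow> (bool list \<Rightarrow> 'a) set" where
  "chains C n i = {c. \<forall>l. if length l = n \<and> int (nT l) = i then c l \<in> C (nF l) else c l = 0}"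

text \<open>Recursion on the last point. A subset avoiding it receives the differential of the shift
  and, from the subset with this point added, the last face. A subset containing it receives minus
  the differential of the module itself; the sign makes the square vanish.\<close>

primrec bd :: "bool list \<Rightarrow> (nat \<Rightarrow> nat \<Rightarrow> 'a \<Rightarrow> 'a) \<Rightarrow> (bool list \<Rightarrow> 'a) \<Rightarrow> 'a::ab_group_add" where
  "bd [] = (\<lambda>\<delta> c. 0)"
| "bd (b # l) = (\<lambda>\<delta> c. if b then - bd l \<delta> (\<lambda>l. c (True # l))
     else bd l (shift \<delta>) (\<lambda>l. c (False # l)) + \<delta> (nF l) (nF l) (c (True # l)))"

definition boundary :: "(nat \<Rightarrow> nat \<Rightarrow> 'a \<Rightarrow> 'a) \<Rightarrow> (bool list \<Rightarrow> 'a) \<Rightarrow> bool list \<Rightarrow> 'a::ab_group_add" where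
  "boundary \<delta> c l = bd l \<delta> c"

text \<open>A chain in degree n + 1 is a pair: \<open>a\<close> collects the subsets avoiding the
  last point and is a chain of the shift, \<open>b\<close> collects those containing it and is a
  chain one homological degree lower. The value 0 at \<open>[]\<close> matches the convention that
  chains vanish on lists of the wrong length.\<close>

definition join :: "(bool list \<Rightarrow> 'a) \<Rightarrow> (bool list \<Rightarrow> 'a) \<Rightarrow> bool list \<Rightarrow> 'a::zero" where
  "join a b l = (case l of [] \<Rightarrow> 0 | x # k \<Rightarrow> if x then b k else a k)"

definition push :: "(nat \<Rightarrow> 'a \<Rightarrow> 'b) \<Rightarrow> (bool list \<Rightarrow> 'a) \<Rightarrow> bool list \<Rightarrow> 'b" where
  "push f c l = f (nF l) (c l)"

definition last_face :: "(nat \<Rightarrow> nat \<Rightarrow> 'a \<Rightarrow> 'a) \<Rightarrow> nat \<Rightarrow> 'a \<Rightarrow> 'a" where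
  "last_face \<delta> m = \<delta> m m"

text \<open>This is the differential of the mapping cone of the last face, seen as a map from the
  complex of a module to that of its shift. It reduces computations in degree n + 1 to degree
  n.\<close>

lemma boundary_join:
  "boundary \<delta> (join a b) = join (boundary (shift \<delta>) a + push (last_face \<delta>) b) (- boundary \<delta> b)"
proof
  fix l show "boundary \<delta> (join a b) l = join (boundary (shift \<delta>) a + push (last_face \<delta>) b) (- boundary \<delta> b) l"
    by (cases l) (auto simp: boundary_def join_def push_def last_face_def)
qed

lemma join_add_diff:
  "join a b + join a' b' = join (a + a') (b + (b' :: bool list \<Rightarrow> 'a::ab_group_add))"
  "join a b - join a' b' = join (a - a') (b - b')"
  by (auto simp: join_def fun_eq_iff split: list.split)

lemma chainsD:
  assumes "c \<in> chains C n i"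
  shows "length l = n \<Longrightarrow> int (nT l) = i \<Longrightarrow> c l \<in> C (nF l)"
    and "\<not> (length l = n \<and> int (nT l) = i) \<Longrightarrow> c l = 0"
  using assms unfolding chains_def mem_Collect_eq by (metis (full_types))+

lemma chainsI:
  assumes "\<And>l. length l = n \<Longrightarrow> int (nT l) = i \<Longrightarrow> c l \<in> C (nF l)"
    and "\<And>l. \<not> (length l = n \<and> int (nT l) = i) \<Longrightarrow> c l = 0"
  shows "c \<in> chains C n i"
  unfolding chains_def mem_Collect_eq using assms by (metis (full_types))

lemma chains_value:
  assumes "c \<in> chains C n i" "\<And>m. subgrp (C m)"
  shows "c l \<in> C (nF l)"
  using chainsD[OF assms(1), of l] subgrpD(1)[OF assms(2)[of "nF l"]] by metis

lemma join_in_chains: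
  "join a b \<in> chains C (Suc n) i \<longleftrightarrow> a \<in> chains (shift C) n i \<and> b \<in> chains C n (i - 1)"
proof
  assume j: "join a b \<in> chains C (Suc n) i"
  show "a \<in> chains (shift C) n i \<and> b \<in> chains C n (i - 1)"
    proof (intro conjI chainsI, goal_cases)
    case (1 l) then show ?case using chainsD(1)[OF j, of "False # l"] by (simp add: shift_def join_def)
  next
    case (2 l) then show ?case using chainsD(2)[OF j, of "False # l"] by (simp add: join_def)
  next
    case (3 l) then show ?case using chainsD(1)[OF j, of "True # l"] by (simp add: join_def)
  next
    case (4 l)
    then have "\<not> (length (True # l) = Suc n \<and> int (nT (True # l)) = i)" by auto
    then show ?case using chainsD(2)[OF j, of "True # l"] by (simp add: join_def)
  qed
next
  assume "a \<in> chains (shift C) n i \<and> b \<in> chains C n (i - 1)"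
  then have a: "a \<in> chains (shift C) n i" and b: "b \<in> chains C n (i - 1)" by auto
  show "join a b \<in> chains C (Suc n) i"
  proof (rule chainsI)
    fix l assume l: "length l = Suc n" "int (nT l) = i"
    then obtain x k where "l = x # k" by (cases l) auto
    then show "join a b l \<in> C (nF l)"
      using l chainsD(1)[OF a, of k] chainsD(1)[OF b, of k] by (cases x) (auto simp: join_def shift_def)
  next
    fix l assume l: "\<not> (length l = Suc n \<and> int (nT l) = i)"
    show "join a b l = 0"
    proof (cases l)
      case Nil then show ?thesis by (simp add: join_def)
    next
      case (Cons x k)
      then show ?thesis using l chainsD(2)[OF a, of k] chainsD(2)[OF b, of k]
        by (cases x) (auto simp: join_def)
    qed
  qed
qed

lemma chains_Suc_cases:
  assumes "c \<in> chains C (Suc n) i"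
  obtains a b where "c = join a b" "a \<in> chains (shift C) n i" "b \<in> chains C n (i - 1)"
proof -
  have "c [] = 0" using chainsD(2)[OF assms, of "[]"] by simp
  then have c: "c = join (\<lambda>l. c (False # l)) (\<lambda>l. c (True # l))"
    by (auto simp: join_def fun_eq_iff split: list.split)
  with assms show ?thesis using that join_in_chains by metis
qed

lemma chains_subgrp: "(\<And>m. subgrp (C m)) \<Longrightarrow> subgrp (chains C n i)"
proof -
  assume C: "\<And>m. subgrp (C m)"
  have "x - y \<in> chains C n i" if x: "x \<in> chains C n i" and y: "y \<in> chains C n i" for x y
  proof (rule chainsI)
    fix l assume "length l = n" "int (nT l) = i"
    then show "(x - y) l \<in> C (nF l)"
      using chainsD(1)[OF x] chainsD(1)[OF y] subgrpD(2)[OF C] by simp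
  next
    fix l assume "\<not> (length l = n \<and> int (nT l) = i)"
    then show "(x - y) l = 0" using chainsD(2)[OF x] chainsD(2)[OF y] by simp
  qed
  moreover have "0 \<in> chains C n i"
    by (rule chainsI) (auto simp: subgrpD(1)[OF C])
  ultimately show ?thesis unfolding subgrp_def by blast
qed

lemma chains_mono: "(\<And>m. A m \<subseteq> C m) \<Longrightarrow> chains A n i \<subseteq> chains C n i"
  by (auto intro!: chainsI dest: chainsD)

lemma chains_eq_0: "\<not> (0 \<le> i \<and> i \<le> int n) \<Longrightarrow> chains C n i \<subseteq> {0}"
proof
  fix c assume i: "\<not> (0 \<le> i \<and> i \<le> int n)" and c: "c \<in> chains C n i"
  have "c l = 0" for l
  proof (rule chainsD(2)[OF c])
    show "\<not> (length l = n \<and> int (nT l) = i)"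
      using i count_le_length[of l True] by auto
  qed
  then show "c \<in> {0}" by (simp add: fun_eq_iff)
qed

lemma nT_nF: "nT l + nF l = length l"
  by (induction l) auto

lemma push_chains:
  "(\<And>x m. x \<in> A m \<Longrightarrow> f m x \<in> A' m) \<Longrightarrow> (\<And>m. f m 0 = 0) \<Longrightarrow> c \<in> chains A n i \<Longrightarrow> push f c \<in> chains A' n i"
  by (auto intro!: chainsI dest: chainsD simp: push_def)

lemma push_diff_add:
  assumes "\<And>m. subgrp (A m)" "\<And>m. additive_on (A m) (f m)" "c \<in> chains A n i" "c' \<in> chains A n i"
  shows "push f (c - c') = push f c - push f c'" "push f (c + c') = push f c + push f c'"
proof -
  have "c l \<in> A (nF l)" "c' l \<in> A (nF l)" for l
    using chains_value assms(1,3,4) by metis+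
  then show "push f (c - c') = push f c - push f c'" "push f (c + c') = push f c + push f c'"
    using additive_onD[OF assms(1,2)] by (auto simp: push_def fun_eq_iff)
qed

lemma face_module_0: "face_module \<delta> C \<Longrightarrow> j \<le> m \<Longrightarrow> \<delta> m j 0 = 0"
  using additive_onD(1)[of "C m" "\<delta> m j"] unfolding face_module_def stable_def by blast

lemma last_face_props:
  assumes "face_module \<delta> C"
  shows "\<And>m. additive_on (C m) (last_face \<delta> m)"
    "\<And>m. last_face \<delta> m 0 = 0"
    "\<And>m x. x \<in> C m \<Longrightarrow> last_face \<delta> m x \<in> shift C m"
  using face_module_0[OF assms] assms unfolding face_module_def stable_def last_face_def shift_def by auto

lemma boundary_degree_0:
  assumes "c \<in> chains A 0 i" "\<And>m j. j \<le> m \<Longrightarrow> \<delta> m j 0 = 0"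
  shows "boundary \<delta> c = 0"
proof
  fix l show "boundary \<delta> c l = 0 l"
  proof (cases l)
    case Nil
    then show ?thesis by (simp add: boundary_def)
  next
    case (Cons b k)
    have "c (x # l) = 0" for x l using chainsD(2)[OF assms(1), of "x # l"] by simp
    moreover have "bd l \<delta> (\<lambda>l. 0) = 0" if "\<And>m j. j \<le> m \<Longrightarrow> \<delta> m j 0 = 0" for l and \<delta> :: "nat \<Rightarrow> nat \<Rightarrow> 'a \<Rightarrow> 'a"
      using that by (induction l arbitrary: \<delta>) (auto simp: shift_def)
    ultimately show ?thesis using Cons assms(2) by (auto simp: boundary_def shift_def)
  qed
qed


lemma boundary_mem_chains_stable:
  assumes "stable \<delta> A" "\<And>m j. j \<le> m \<Longrightarrow> \<delta> m j 0 = 0" "c \<in> chains A n i"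
  shows "boundary \<delta> c \<in> chains A n (i - 1)"
  using assms
proof (induction n arbitrary: A \<delta> c i)
  case 0
  have "boundary \<delta> c = 0" using boundary_degree_0[OF 0(3)] 0(2) by blast
  then show ?case using chains_subgrp[of A 0 "i - 1"] 0(1) subgrpD(1) unfolding stable_def by metis
next
  case (Suc n)
  obtain a b where c: "c = join a b" and a: "a \<in> chains (shift A) n i" and b: "b \<in> chains A n (i - 1)"
    using chains_Suc_cases[OF Suc.prems(3)] by blast
  have "boundary (shift \<delta>) a \<in> chains (shift A) n (i - 1)"
    by (rule Suc.IH[OF stable_shift[OF Suc.prems(1)] _ a]) (simp add: shift_def Suc.prems(2))
  moreover have "push (last_face \<delta>) b \<in> chains (shift A) n (i - 1)"
    using Suc.prems(1,2) unfolding stable_def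
    by (intro push_chains[OF _ _ b]) (auto simp: last_face_def shift_def)
  moreover have "boundary \<delta> b \<in> chains A n (i - 1 - 1)"
    by (rule Suc.IH[OF Suc.prems(1,2) b])
  ultimately show ?case
    unfolding c boundary_join join_in_chains
    using subgrpD(3,4)[OF chains_subgrp] stable_subgrp[OF Suc.prems(1)] stable_subgrp[OF stable_shift[OF Suc.prems(1)]]
    by blast
qed

lemma boundary_mem_chains:
  assumes "face_module \<delta> C" "stable \<delta> A" "c \<in> chains A n i"
  shows "boundary \<delta> c \<in> chains A n (i - 1)"
  using boundary_mem_chains_stable[OF assms(2) _ assms(3)] face_module_0[OF assms(1)] by blast

lemma boundary_linear:
  assumes "face_module \<delta> C" "c \<in> chains C n i" "c' \<in> chains C n i"
  shows "boundary \<delta> (c + c') = boundary \<delta> c + boundary \<delta> c'"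
  using assms
proof (induction n arbitrary: C \<delta> c c' i)
  case 0
  have "boundary \<delta> c = 0" if "c \<in> chains C 0 i" for c
    using boundary_degree_0[OF that] face_module_0[OF 0(1)] by blast
  moreover have "c + c' \<in> chains C 0 i"
    using 0 subgrpD(3)[OF chains_subgrp[of C, OF face_module_subgrp[OF 0(1)]]] by blast
  ultimately show ?case using 0(2,3) by (metis add.right_neutral)
next
  case (Suc n)
  obtain a b where c: "c = join a b" and a: "a \<in> chains (shift C) n i" and b: "b \<in> chains C n (i - 1)"
    using chains_Suc_cases[OF Suc.prems(2)] by blast
  obtain a' b' where c': "c' = join a' b'" and a': "a' \<in> chains (shift C) n i" and b': "b' \<in> chains C n (i - 1)"
    using chains_Suc_cases[OF Suc.prems(3)] by blast
  have "push (last_face \<delta>) (b + b') = push (last_face \<delta>) b + push (last_face \<delta>) b'"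
    by (rule push_diff_add(2)[OF face_module_subgrp[OF Suc.prems(1)] last_face_props(1)[OF Suc.prems(1)] b b'])
  then show ?case
    using Suc.IH[OF face_module_shift[OF Suc.prems(1)] a a'] Suc.IH[OF Suc.prems(1) b b']
    unfolding c c' boundary_join join_add_diff by (simp only: add.assoc add.left_commute minus_add_distrib)
qed

lemma boundary_additive_on:
  "face_module \<delta> C \<Longrightarrow> additive_on (chains C n i) (boundary \<delta>)"
  using boundary_linear unfolding additive_on_def by blast

lemma push_uminus:
  assumes "\<And>m. subgrp (A m)" "\<And>m. additive_on (A m) (f m)" "c \<in> chains A n i"
  shows "push f (- c) = - push f c"
  using additive_onD(4)[OF assms(1,2)] chains_value[OF assms(3,1)] by (simp add: push_def fun_eq_iff)

lemma push_join: "f 0 0 = 0 \<Longrightarrow> push f (join a b) = join (push (shift f) a) (push f b)"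
  by (auto simp: push_def join_def shift_def fun_eq_iff split: list.split)

lemma push_last_face_chains:
  "face_module \<delta> C \<Longrightarrow> c \<in> chains C n i \<Longrightarrow> push (last_face \<delta>) c \<in> chains (shift C) n i"
  using push_chains[of C "last_face \<delta>" "shift C" c] last_face_props(2,3)[of \<delta> C] by blast

text \<open>Naturality of the Koszul complex in the module. The modules and the map vary in the
  induction because the first component of a chain is transported by the shifted map.\<close>

lemma boundary_push:
  assumes "face_module \<delta> C" "face_module \<delta>' C'" "\<And>m. additive_on (C m) (f m)"
    and "\<And>m x. x \<in> C m \<Longrightarrow> f m x \<in> C' m"
    and "\<And>m j x. j \<le> m \<Longrightarrow> x \<in> C m \<Longrightarrow> f (Suc m) (\<delta> m j x) = \<delta>' m j (f m x)"
    and "c \<in> chains C n i"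
  shows "boundary \<delta>' (push f c) = push f (boundary \<delta> c)"
  using assms
proof (induction n arbitrary: C C' \<delta> \<delta>' f c i)
  case 0
  have f0: "f m 0 = 0" for m using additive_onD(1)[OF face_module_subgrp[OF 0(1)] 0(3)] .
  have "boundary \<delta> c = 0" using boundary_degree_0[OF 0(6)] face_module_0[OF 0(1)] by blast
  moreover have "boundary \<delta>' (push f c) = 0"
    using boundary_degree_0[OF push_chains[of C f C', OF 0(4) f0 0(6)]] face_module_0[OF 0(2)] by blast
  moreover have "push f 0 = 0" using f0 by (simp add: push_def fun_eq_iff)
  ultimately show ?case by metis
next
  case (Suc n)
  note fm = Suc.prems(1) and fm' = Suc.prems(2) and add = Suc.prems(3)
  note g = face_module_subgrp[OF fm]
  note gs = face_module_subgrp[OF face_module_shift[OF fm]]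
  have f0: "f m 0 = 0" for m using additive_onD(1)[OF g add] .
  have adds: "additive_on (shift C m) (shift f m)" for m using add by (simp add: shift_def)
  obtain a b where c: "c = join a b" and a: "a \<in> chains (shift C) n i" and b: "b \<in> chains C n (i - 1)"
    using chains_Suc_cases[OF Suc.prems(6)] by blast
  have 1: "boundary (shift \<delta>') (push (shift f) a) = push (shift f) (boundary (shift \<delta>) a)"
    by (rule Suc.IH[OF face_module_shift[OF fm] face_module_shift[OF fm'] adds _ _ a])
      (auto simp: shift_def Suc.prems)
  have 2: "boundary \<delta>' (push f b) = push f (boundary \<delta> b)"
    by (rule Suc.IH[OF fm fm' add _ _ b]) (auto simp: Suc.prems)
  have ba: "boundary (shift \<delta>) a \<in> chains (shift C) n (i - 1)"
    using boundary_mem_chains[OF face_module_shift[OF fm] face_module_stable[OF face_module_shift[OF fm]] a] .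
  have lb: "push (last_face \<delta>) b \<in> chains (shift C) n (i - 1)"
    using push_last_face_chains[OF fm b] .
  have bb: "boundary \<delta> b \<in> chains C n (i - 1 - 1)"
    using boundary_mem_chains[OF fm face_module_stable[OF fm] b] .
  have 3: "push (last_face \<delta>') (push f b) = push (shift f) (push (last_face \<delta>) b)"
    using Suc.prems(5) chains_value[OF b g] by (simp add: push_def last_face_def shift_def fun_eq_iff)
  show ?case
    unfolding c push_join[of f, OF f0] boundary_join
    unfolding 1 2 3 push_diff_add(2)[OF gs adds ba lb] push_uminus[OF g add bb] by simp
qed

text \<open>The face identity with the last position as upper index. It makes the last face a
  morphism from the module to its shift.\<close>

lemma last_face_commute:
  assumes "face_module \<delta> C" "j \<le> m" "x \<in> C m"
  shows "last_face \<delta> (Suc m) (\<delta> m j x) = shift \<delta> m j (last_face \<delta> m x)"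
  using assms unfolding face_module_def last_face_def shift_def by auto

lemma boundary_push_last_face:
  assumes "face_module \<delta> C" "c \<in> chains C n i"
  shows "boundary (shift \<delta>) (push (last_face \<delta>) c) = push (last_face \<delta>) (boundary \<delta> c)"
  using last_face_props[OF assms(1)] last_face_commute[OF assms(1)]
  by (intro boundary_push[OF assms(1) face_module_shift[OF assms(1)] _ _ _ assms(2)])

lemma boundary_diff:
  assumes "face_module \<delta> C" "c \<in> chains C n i" "c' \<in> chains C n i"
  shows "boundary \<delta> (c - c') = boundary \<delta> c - boundary \<delta> c'"
  by (rule additive_onD(3)[OF chains_subgrp[of C] boundary_additive_on[OF assms(1)] assms(2,3)])
    (rule face_module_subgrp[OF assms(1)])

lemma boundary_uminus:
  assumes "face_module \<delta> C" "c \<in> chains C n i"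
  shows "boundary \<delta> (- c) = - boundary \<delta> c"
  by (rule additive_onD(4)[OF chains_subgrp[of C] boundary_additive_on[OF assms(1)] assms(2)])
    (rule face_module_subgrp[OF assms(1)])

text \<open>In the first component of the cone, the last face of the boundary of \<open>b\<close>
  appears once with each sign, since the last face commutes with the differentials.\<close>

lemma boundary_boundary:
  assumes "face_module \<delta> C" "c \<in> chains C n i"
  shows "boundary \<delta> (boundary \<delta> c) = 0"
  using assms
proof (induction n arbitrary: C \<delta> c i)
  case 0
  have "boundary \<delta> c = 0" "boundary \<delta> 0 = 0"
    using boundary_degree_0[of _ C _ \<delta>] subgrpD(1)[OF chains_subgrp[of C, OF face_module_subgrp[OF 0(1)]]]
      face_module_0[OF 0(1)] 0(2) by blast+
  then show ?case by metis
next
  case (Suc n)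
  note fm = Suc.prems(1)
  note fms = face_module_shift[OF fm]
  obtain a b where c: "c = join a b" and a: "a \<in> chains (shift C) n i" and b: "b \<in> chains C n (i - 1)"
    using chains_Suc_cases[OF Suc.prems(2)] by blast
  have ba: "boundary (shift \<delta>) a \<in> chains (shift C) n (i - 1)"
    using boundary_mem_chains[OF fms face_module_stable[OF fms] a] .
  have lb: "push (last_face \<delta>) b \<in> chains (shift C) n (i - 1)"
    using push_last_face_chains[OF fm b] .
  have bb: "boundary \<delta> b \<in> chains C n (i - 1 - 1)"
    using boundary_mem_chains[OF fm face_module_stable[OF fm] b] .
  show ?case
    unfolding c boundary_join boundary_linear[OF fms ba lb] Suc.IH[OF fms a] boundary_push_last_face[OF fm b]
      boundary_uminus[OF fm bb] Suc.IH[OF fm b]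
      push_uminus[OF face_module_subgrp[OF fm] last_face_props(1)[OF fm] bb]
    by (auto simp: join_def fun_eq_iff split: list.split)
qed

text \<open>Modules are represented as subquotients \<open>C / B\<close>, so that derivatives stay within one type.\<close>

definition subquotient :: "(nat \<Rightarrow> nat \<Rightarrow> 'a \<Rightarrow> 'a) \<Rightarrow> (nat \<Rightarrow> 'a::ab_group_add set) \<Rightarrow> (nat \<Rightarrow> 'a set) \<Rightarrow> bool" where
  "subquotient \<delta> C B \<longleftrightarrow> face_module \<delta> C \<and> stable \<delta> B \<and> (\<forall>m. B m \<subseteq> C m)"

text \<open>Homology of the complex of chains in \<open>C\<close> modulo chains in \<open>B\<close>,
  tested on representatives. The degree \<open>i\<close> is an integer so that \<open>i - 1\<close>
  is not truncated; negative degrees carry only the zero chain.\<close>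

definition homology_vanishes ::
  "(nat \<Rightarrow> nat \<Rightarrow> 'a \<Rightarrow> 'a) \<Rightarrow> (nat \<Rightarrow> 'a::ab_group_add set) \<Rightarrow> (nat \<Rightarrow> 'a set) \<Rightarrow> nat \<Rightarrow> int \<Rightarrow> bool" where
  "homology_vanishes \<delta> C B n i \<longleftrightarrow>
     (\<forall>x\<in>chains C n i. boundary \<delta> x \<in> chains B n (i - 1) \<longrightarrow>
        (\<exists>e\<in>chains C n (i + 1). x - boundary \<delta> e \<in> chains B n i))"

text \<open>For \<open>V = C / B\<close> the pairs (\<^term>\<open>shift C\<close>, \<^term>\<open>deriv_sub \<delta> C B\<close>) and
  (\<^term>\<open>ker_sub \<delta> C B\<close>, \<^term>\<open>B\<close>) are the cokernel and the kernel of the map from \<open>V\<close> to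
  its shift given by the last face.\<close>

definition deriv_sub ::
  "(nat \<Rightarrow> nat \<Rightarrow> 'a \<Rightarrow> 'a) \<Rightarrow> (nat \<Rightarrow> 'a::ab_group_add set) \<Rightarrow> (nat \<Rightarrow> 'a set) \<Rightarrow> nat \<Rightarrow> 'a set" where
  "deriv_sub \<delta> C B m = {b + last_face \<delta> m c |b c. b \<in> B (Suc m) \<and> c \<in> C m}"

definition ker_sub ::
  "(nat \<Rightarrow> nat \<Rightarrow> 'a \<Rightarrow> 'a) \<Rightarrow> (nat \<Rightarrow> 'a::ab_group_add set) \<Rightarrow> (nat \<Rightarrow> 'a set) \<Rightarrow> nat \<Rightarrow> 'a set" where
  "ker_sub \<delta> C B m = {x \<in> C m. last_face \<delta> m x \<in> B (Suc m)}"

lemma subquotientD: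
  assumes "subquotient \<delta> C B"
  shows "face_module \<delta> C" "stable \<delta> B" "B m \<subseteq> C m" "stable \<delta> C" "subgrp (C m)" "subgrp (B m)"
    "\<And>j x. j \<le> m \<Longrightarrow> x \<in> B m \<Longrightarrow> \<delta> m j x \<in> B (Suc m)"
    "\<And>j x. j \<le> m \<Longrightarrow> x \<in> C m \<Longrightarrow> \<delta> m j x \<in> C (Suc m)"
    "\<And>x. x \<in> B m \<Longrightarrow> last_face \<delta> m x \<in> B (Suc m)"
    "\<And>x. x \<in> C m \<Longrightarrow> last_face \<delta> m x \<in> C (Suc m)"
    "\<And>j. j \<le> m \<Longrightarrow> additive_on (C m) (\<delta> m j)"
    "additive_on (C m) (last_face \<delta> m)"
  using assms unfolding subquotient_def face_module_def stable_def last_face_def by auto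

lemma subgrp_shift: "(\<And>m. subgrp (C m)) \<Longrightarrow> subgrp (shift C m)"
  by (simp add: shift_def)

lemma subquotient_deriv:
  assumes "subquotient \<delta> C B"
  shows "subquotient (shift \<delta>) (shift C) (deriv_sub \<delta> C B)"
proof -
  note D = subquotientD[OF assms]
  note lf = additive_onD[OF D(5,12)]
  have 1: "subgrp (deriv_sub \<delta> C B m)" for m
    unfolding subgrp_def
  proof (intro conjI ballI)
    have "0 = 0 + last_face \<delta> m 0" using lf(1) by simp
    then show "0 \<in> deriv_sub \<delta> C B m"
      unfolding deriv_sub_def using subgrpD(1)[OF D(6)] subgrpD(1)[OF D(5)] by blast
    fix x y assume "x \<in> deriv_sub \<delta> C B m" "y \<in> deriv_sub \<delta> C B m"
    then obtain b c b' c' where "x = b + last_face \<delta> m c" "y = b' + last_face \<delta> m c'"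
      and m: "b \<in> B (Suc m)" "b' \<in> B (Suc m)" "c \<in> C m" "c' \<in> C m"
      unfolding deriv_sub_def by blast
    then have "x - y = (b - b') + last_face \<delta> m (c - c')" using lf(3)[OF m(3,4)] by simp
    then show "x - y \<in> deriv_sub \<delta> C B m"
      unfolding deriv_sub_def using subgrpD(2)[OF D(6) m(1,2)] subgrpD(2)[OF D(5) m(3,4)] by blast
  qed
  have 2: "shift \<delta> m j x \<in> deriv_sub \<delta> C B (Suc m)" if j: "j \<le> m" and x: "x \<in> deriv_sub \<delta> C B m" for m j x
  proof -
    obtain b c where x: "x = b + last_face \<delta> m c" and b: "b \<in> B (Suc m)" and c: "c \<in> C m"
      using x unfolding deriv_sub_def by blast
    have bC: "b \<in> C (Suc m)" using b D(3) by blast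
    have "shift \<delta> m j x = shift \<delta> m j b + shift \<delta> m j (last_face \<delta> m c)"
      unfolding x shift_def using additive_onD(2)[OF D(5,11)] bC D(10)[OF c] j by simp
    also have "\<dots> = \<delta> (Suc m) j b + last_face \<delta> (Suc m) (\<delta> m j c)"
      using last_face_commute[OF D(1) j c] by (simp add: shift_def)
    finally show ?thesis
      unfolding deriv_sub_def using D(7)[of j "Suc m" b] D(8)[OF j c] b j by fastforce
  qed
  have 3: "deriv_sub \<delta> C B m \<subseteq> shift C m" for m
    unfolding deriv_sub_def shift_def using D(3,10) subgrpD(3)[OF D(5)] by blast
  show ?thesis
    unfolding subquotient_def stable_def using face_module_shift[OF D(1)] 1 2 3 by blast
qed

lemma subquotient_ker:
  assumes "subquotient \<delta> C B"
  shows "stable \<delta> (ker_sub \<delta> C B)" "B m \<subseteq> ker_sub \<delta> C B m" "ker_sub \<delta> C B m \<subseteq> C m"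
proof -
  note D = subquotientD[OF assms]
  note lf = additive_onD[OF D(5,12)]
  have 1: "subgrp (ker_sub \<delta> C B m)" for m
    unfolding subgrp_def ker_sub_def
    using lf(1,3) subgrpD(1,2)[OF D(5)] subgrpD(1,2)[OF D(6)] by auto
  have 2: "\<delta> m j x \<in> ker_sub \<delta> C B (Suc m)" if j: "j \<le> m" and x: "x \<in> ker_sub \<delta> C B m" for m j x
  proof -
    have x: "x \<in> C m" "last_face \<delta> m x \<in> B (Suc m)" using x by (auto simp: ker_sub_def)
    have "last_face \<delta> (Suc m) (\<delta> m j x) = \<delta> (Suc m) j (last_face \<delta> m x)"
      using last_face_commute[OF D(1) j x(1)] by (simp add: shift_def)
    then show ?thesis using D(7)[of j "Suc m"] x j D(8)[OF j x(1)] by (simp add: ker_sub_def)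
  qed
  show "stable \<delta> (ker_sub \<delta> C B)" using 1 2 by (simp add: stable_def)
  show "B m \<subseteq> ker_sub \<delta> C B m" "ker_sub \<delta> C B m \<subseteq> C m"
    using D(3,9) by (auto simp: ker_sub_def)
qed

lemma face_module_sub: "face_module \<delta> C \<Longrightarrow> stable \<delta> A \<Longrightarrow> (\<And>m. A m \<subseteq> C m) \<Longrightarrow> face_module \<delta> A"
  unfolding face_module_def additive_on_def subset_iff by simp

lemma subquotient_ker_sub:
  assumes "subquotient \<delta> C B"
  shows "subquotient \<delta> (ker_sub \<delta> C B) B"
  using face_module_sub[OF subquotientD(1)[OF assms] subquotient_ker(1,3)[OF assms]]
    subquotientD(2)[OF assms] subquotient_ker(2)[OF assms] unfolding subquotient_def by blast

text \<open>Chains are independent families of coefficients, so the decomposition of an element of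
  \<open>deriv_sub\<close> can be chosen at each subset separately, with 0 elsewhere.\<close>

lemma deriv_chains_split:
  assumes "subquotient \<delta> C B" "x \<in> chains (deriv_sub \<delta> C B) n i"
  obtains \<beta> \<gamma> where "\<beta> \<in> chains (shift B) n i" "\<gamma> \<in> chains C n i" "x = \<beta> + push (last_face \<delta>) \<gamma>"
proof -
  note D = subquotientD[OF assms(1)]
  define inn where "inn l \<longleftrightarrow> length l = n \<and> int (nT l) = i" for l
  have "\<exists>b c. inn l \<longrightarrow> b \<in> B (Suc (nF l)) \<and> c \<in> C (nF l) \<and> x l = b + last_face \<delta> (nF l) c" for l
  proof (cases "inn l")
    case True
    then have "x l \<in> deriv_sub \<delta> C B (nF l)" using chainsD(1)[OF assms(2)] by (simp add: inn_def)
    then show ?thesis unfolding deriv_sub_def by blast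
  qed simp
  then obtain b c where bc: "\<And>l. inn l \<Longrightarrow> b l \<in> B (Suc (nF l)) \<and> c l \<in> C (nF l) \<and> x l = b l + last_face \<delta> (nF l) (c l)"
    using choice[of "\<lambda>l p. inn l \<longrightarrow> fst p \<in> B (Suc (nF l)) \<and> snd p \<in> C (nF l) \<and> x l = fst p + last_face \<delta> (nF l) (snd p)"]
    by force
  define \<beta> where "\<beta> l = (if inn l then b l else 0)" for l
  define \<gamma> where "\<gamma> l = (if inn l then c l else 0)" for l
  have "\<beta> \<in> chains (shift B) n i" "\<gamma> \<in> chains C n i"
    by (rule chainsI; use bc in \<open>auto simp: \<beta>_def \<gamma>_def inn_def shift_def\<close>)+
  moreover have "x = \<beta> + push (last_face \<delta>) \<gamma>"
  proof
    fix l show "x l = (\<beta> + push (last_face \<delta>) \<gamma>) l"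
      using bc[of l] chainsD(2)[OF assms(2), of l] last_face_props(2)[OF D(1)]
      by (cases "inn l") (auto simp: \<beta>_def \<gamma>_def push_def inn_def)
  qed
  ultimately show ?thesis using that by blast
qed

lemma deriv_chains_join:
  assumes "subquotient \<delta> C B" "\<beta> \<in> chains (shift B) n i" "\<gamma> \<in> chains C n i"
  shows "\<beta> + push (last_face \<delta>) \<gamma> \<in> chains (deriv_sub \<delta> C B) n i"
proof (rule chainsI)
  fix l assume "length l = n" "int (nT l) = i"
  then show "(\<beta> + push (last_face \<delta>) \<gamma>) l \<in> deriv_sub \<delta> C B (nF l)"
    using chainsD(1)[OF assms(2), of l] chainsD(1)[OF assms(3), of l]
    unfolding deriv_sub_def by (auto simp: push_def shift_def)
next
  fix l assume "\<not> (length l = n \<and> int (nT l) = i)"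
  then show "(\<beta> + push (last_face \<delta>) \<gamma>) l = 0"
    using chainsD(2)[OF assms(2), of l] chainsD(2)[OF assms(3), of l] last_face_props(2)[OF subquotientD(1)[OF assms(1)]]
    by (simp add: push_def)
qed

lemma ker_chains:
  assumes "c \<in> chains C n i" "push (last_face \<delta>) c \<in> chains (shift B) n i"
  shows "c \<in> chains (ker_sub \<delta> C B) n i"
proof (rule chainsI)
  fix l assume "length l = n" "int (nT l) = i"
  then show "c l \<in> ker_sub \<delta> C B (nF l)"
    using chainsD(1)[OF assms(1), of l] chainsD(1)[OF assms(2), of l] by (simp add: push_def ker_sub_def shift_def)
qed (rule chainsD(2)[OF assms(1)])

lemma push_ker_chains:
  assumes "subquotient \<delta> C B" "c \<in> chains (ker_sub \<delta> C B) n i"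
  shows "push (last_face \<delta>) c \<in> chains (shift B) n i"
proof (rule chainsI)
  fix l assume "length l = n" "int (nT l) = i"
  then show "push (last_face \<delta>) c l \<in> shift B (nF l)"
    using chainsD(1)[OF assms(2), of l] by (simp add: push_def ker_sub_def shift_def)
next
  fix l assume "\<not> (length l = n \<and> int (nT l) = i)"
  then show "push (last_face \<delta>) c l = 0"
    using chainsD(2)[OF assms(2), of l] last_face_props(2)[OF subquotientD(1)[OF assms(1)]] by (simp add: push_def)
qed

section \<open>The long exact sequence of kernel and derivative\<close>

lemma homology_vanishesD:
  assumes "homology_vanishes \<delta> C B n i" "x \<in> chains C n i" "boundary \<delta> x \<in> chains B n (i - 1)"
  obtains e where "e \<in> chains C n (i + 1)" "x - boundary \<delta> e \<in> chains B n i"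
  using assms unfolding homology_vanishes_def by blast

text \<open>Exactness at \<open>H_p(V)_{n+1}\<close>. The first component of a cycle is a cycle of
  the derivative; killing it there leaves a second component in the kernel, which is killed in
  turn.\<close>

lemma homology_vanishes_shift_deriv:
  assumes sq: "subquotient \<delta> C B"
    and K: "homology_vanishes \<delta> (ker_sub \<delta> C B) B n (p - 1)"
    and D: "homology_vanishes (shift \<delta>) (shift C) (deriv_sub \<delta> C B) n p"
  shows "homology_vanishes \<delta> C B (Suc n) p"
  unfolding homology_vanishes_def
proof (intro ballI impI)
  note S = subquotientD[OF sq]
  note fms = face_module_shift[OF S(1)]
  note gC = chains_subgrp[of C, OF S(5)] and gB = chains_subgrp[of B, OF S(6)]
  note gBs = chains_subgrp[of "shift B", OF subgrp_shift[of B, OF S(6)]]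
  note pd = push_diff_add[of C "last_face \<delta>", OF S(5,12)]
  note pC = push_last_face_chains[OF S(1)]
  note Km = chains_mono[of "ker_sub \<delta> C B" C, OF subquotient_ker(3)[OF sq], THEN subsetD]
  fix c assume "c \<in> chains C (Suc n) p" and bc: "boundary \<delta> c \<in> chains B (Suc n) (p - 1)"
  then obtain a b where c: "c = join a b" and a: "a \<in> chains (shift C) n p" and b: "b \<in> chains C n (p - 1)"
    using chains_Suc_cases by blast
  have 1: "boundary (shift \<delta>) a + push (last_face \<delta>) b \<in> chains (shift B) n (p - 1)"
    and 2: "- boundary \<delta> b \<in> chains B n (p - 1 - 1)"
    using bc unfolding c boundary_join join_in_chains by auto
  have "boundary (shift \<delta>) a + push (last_face \<delta>) b + push (last_face \<delta>) (- b) = boundary (shift \<delta>) a"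
    using push_uminus[OF S(5,12) b] by simp
  then have "boundary (shift \<delta>) a \<in> chains (deriv_sub \<delta> C B) n (p - 1)"
    using deriv_chains_join[OF sq 1 subgrpD(4)[OF gC b]] by metis
  then obtain e where e: "e \<in> chains (shift C) n (p + 1)" "a - boundary (shift \<delta>) e \<in> chains (deriv_sub \<delta> C B) n p"
    using homology_vanishesD[OF D a] by blast
  obtain \<beta> \<gamma> where \<beta>: "\<beta> \<in> chains (shift B) n p" and \<gamma>: "\<gamma> \<in> chains C n p"
    and ae: "a - boundary (shift \<delta>) e = \<beta> + push (last_face \<delta>) \<gamma>"
    using deriv_chains_split[OF sq e(2)] by blast
  have be: "boundary (shift \<delta>) e \<in> chains (shift C) n p"
    using boundary_mem_chains[OF fms face_module_stable[OF fms] e(1)] by simp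
  have bg: "boundary \<delta> \<gamma> \<in> chains C n (p - 1)"
    by (rule boundary_mem_chains[OF S(1,4) \<gamma>])
  \<comment> \<open>Subtracting the boundary of \<open>join e \<gamma>\<close> from the cycle leaves
    \<open>join \<beta> \<kappa>\<close>, with \<open>\<beta>\<close> already in \<open>B\<close>.
    The cycle condition then forces the last face of \<open>\<kappa>\<close> into
    \<open>B\<close>.\<close>
  define \<kappa> where "\<kappa> = b + boundary \<delta> \<gamma>"
  have \<kappa>C: "\<kappa> \<in> chains C n (p - 1)" unfolding \<kappa>_def using subgrpD(3)[OF gC b bg] .
  have b\<beta>: "boundary (shift \<delta>) \<beta> \<in> chains (shift B) n (p - 1)"
    by (rule boundary_mem_chains[OF fms stable_shift[OF S(2)] \<beta>])
  have \<beta>C: "\<beta> \<in> chains (shift C) n p"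
    using chains_mono[of "shift B" "shift C"] \<beta> S(3) unfolding shift_def by blast
  have "boundary (shift \<delta>) (a - boundary (shift \<delta>) e) = boundary (shift \<delta>) a"
    using boundary_diff[OF fms a be] boundary_boundary[OF fms e(1)] by simp
  moreover have "boundary (shift \<delta>) (\<beta> + push (last_face \<delta>) \<gamma>) = boundary (shift \<delta>) \<beta> + push (last_face \<delta>) (boundary \<delta> \<gamma>)"
    using boundary_linear[OF fms \<beta>C pC[OF \<gamma>]] boundary_push_last_face[OF S(1) \<gamma>] by simp
  ultimately have ba: "boundary (shift \<delta>) a = boundary (shift \<delta>) \<beta> + push (last_face \<delta>) (boundary \<delta> \<gamma>)"
    using ae by metis
  have "push (last_face \<delta>) \<kappa> = push (last_face \<delta>) b + push (last_face \<delta>) (boundary \<delta> \<gamma>)"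
    unfolding \<kappa>_def by (rule pd(2)[OF b bg])
  also have "\<dots> = (boundary (shift \<delta>) a + push (last_face \<delta>) b) - boundary (shift \<delta>) \<beta>"
    unfolding ba by (simp only: algebra_simps)
  also have "\<dots> \<in> chains (shift B) n (p - 1)" by (rule subgrpD(2)[OF gBs 1 b\<beta>])
  finally have \<kappa>: "\<kappa> \<in> chains (ker_sub \<delta> C B) n (p - 1)" by (rule ker_chains[OF \<kappa>C])
  have "boundary \<delta> \<kappa> = boundary \<delta> b"
    unfolding \<kappa>_def using boundary_linear[OF S(1) b bg] boundary_boundary[OF S(1) \<gamma>] by simp
  also have "\<dots> \<in> chains B n (p - 1 - 1)" using subgrpD(4)[OF gB 2] by simp
  finally obtain \<epsilon> where \<epsilon>: "\<epsilon> \<in> chains (ker_sub \<delta> C B) n p" "\<kappa> - boundary \<delta> \<epsilon> \<in> chains B n (p - 1)"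
    using homology_vanishesD[OF K \<kappa>] by auto
  have \<epsilon>C: "\<epsilon> \<in> chains C n p" using Km[OF \<epsilon>(1)] .
  show "\<exists>e\<in>chains C (Suc n) (p + 1). c - boundary \<delta> e \<in> chains B (Suc n) p"
  \<comment> \<open>Correcting \<open>\<gamma>\<close> by \<open>\<epsilon>\<close> replaces the
    second component \<open>\<kappa>\<close> by an element of \<open>B\<close>. The first changes
    only by the last face of a kernel chain, which lies in \<open>B\<close>.\<close>
  proof (rule bexI[of _ "join e (\<gamma> - \<epsilon>)"])
    have l1: "boundary \<delta> (\<gamma> - \<epsilon>) = boundary \<delta> \<gamma> - boundary \<delta> \<epsilon>" by (rule boundary_diff[OF S(1) \<gamma> \<epsilon>C])
    have l2: "push (last_face \<delta>) (\<gamma> - \<epsilon>) = push (last_face \<delta>) \<gamma> - push (last_face \<delta>) \<epsilon>" by (rule pd(1)[OF \<gamma> \<epsilon>C])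
    have "c - boundary \<delta> (join e (\<gamma> - \<epsilon>)) =
        join ((a - boundary (shift \<delta>) e) - push (last_face \<delta>) \<gamma> + push (last_face \<delta>) \<epsilon>)
         (b + boundary \<delta> \<gamma> - boundary \<delta> \<epsilon>)"
      unfolding c boundary_join join_add_diff l1 l2 by (simp only: algebra_simps minus_diff_eq diff_minus_eq_add)
    also have "\<dots> = join (\<beta> + push (last_face \<delta>) \<epsilon>) (\<kappa> - boundary \<delta> \<epsilon>)"
      unfolding ae \<kappa>_def by (simp only: algebra_simps add_diff_cancel)
    also have "\<dots> \<in> chains B (Suc n) p"
      unfolding join_in_chains using subgrpD(3)[OF gBs \<beta> push_ker_chains[OF sq \<epsilon>(1)]] \<epsilon>(2) by blast
    finally show "c - boundary \<delta> (join e (\<gamma> - \<epsilon>)) \<in> chains B (Suc n) p" .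
    show "join e (\<gamma> - \<epsilon>) \<in> chains C (Suc n) (p + 1)"
      unfolding join_in_chains using e(1) subgrpD(2)[OF gC \<gamma> \<epsilon>C] by simp
  qed
qed

text \<open>The obstruction to lifting a cycle \<open>a\<close> of the derivative to a cycle
  \<open>join a (- b)\<close> of \<open>V\<close> is the boundary of \<open>b\<close>, which
  represents the connecting map to \<open>H_{p-2}(KV)_n\<close>. For \<open>p \<le> 1\<close> it
  lies in negative degree, so every class lifts.\<close>

lemma homology_vanishes_deriv:
  assumes sq: "subquotient \<delta> C B" and "p \<le> 1"
    and V: "homology_vanishes \<delta> C B (Suc n) p"
  shows "homology_vanishes (shift \<delta>) (shift C) (deriv_sub \<delta> C B) n p"
  unfolding homology_vanishes_def
proof (intro ballI impI)
  note S = subquotientD[OF sq]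
  note fms = face_module_shift[OF S(1)]
  note gC = chains_subgrp[of C, OF S(5)] and gB = chains_subgrp[of B, OF S(6)]
  fix a assume a: "a \<in> chains (shift C) n p" and "boundary (shift \<delta>) a \<in> chains (deriv_sub \<delta> C B) n (p - 1)"
  then obtain \<beta> b where \<beta>: "\<beta> \<in> chains (shift B) n (p - 1)" and b: "b \<in> chains C n (p - 1)"
    and ba: "boundary (shift \<delta>) a = \<beta> + push (last_face \<delta>) b"
    using deriv_chains_split[OF sq] by blast
  have nb: "- b \<in> chains C n (p - 1)" using subgrpD(4)[OF gC b] .
  have "boundary \<delta> (- b) \<in> {0}"
    using boundary_mem_chains[OF S(1,4) nb] chains_eq_0[of "p - 1 - 1" n C] \<open>p \<le> 1\<close> by auto
  then have "boundary \<delta> (join a (- b)) = join \<beta> 0"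
    unfolding boundary_join ba push_uminus[OF S(5,12) b] by simp
  then have "boundary \<delta> (join a (- b)) \<in> chains B (Suc n) (p - 1)"
    using join_in_chains[of \<beta> 0 B n "p - 1"] \<beta> subgrpD(1)[OF gB] by simp
  moreover have "join a (- b) \<in> chains C (Suc n) p"
    unfolding join_in_chains using a nb by simp
  ultimately obtain f where f: "f \<in> chains C (Suc n) (p + 1)" "join a (- b) - boundary \<delta> f \<in> chains B (Suc n) p"
    using homology_vanishesD[OF V] by blast
  obtain e \<gamma> where fe: "f = join e \<gamma>" and e: "e \<in> chains (shift C) n (p + 1)" and \<gamma>: "\<gamma> \<in> chains C n p"
    using chains_Suc_cases[OF f(1)] by auto
  have 1: "a - (boundary (shift \<delta>) e + push (last_face \<delta>) \<gamma>) \<in> chains (shift B) n p"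
    using f(2) unfolding fe boundary_join join_add_diff join_in_chains by blast
  have "a - (boundary (shift \<delta>) e + push (last_face \<delta>) \<gamma>) + push (last_face \<delta>) \<gamma> = a - boundary (shift \<delta>) e"
    by (simp only: algebra_simps)
  then have "a - boundary (shift \<delta>) e \<in> chains (deriv_sub \<delta> C B) n p"
    using deriv_chains_join[OF sq 1 \<gamma>] by metis
  then show "\<exists>e\<in>chains (shift C) n (p + 1). a - boundary (shift \<delta>) e \<in> chains (deriv_sub \<delta> C B) n p"
    using e by blast
qed

text \<open>Exactness at \<open>H_p(KV)_n\<close>. A kernel cycle \<open>x\<close> gives the cycle
  \<open>join 0 x\<close> of \<open>V\<close>. If \<open>join e \<gamma>\<close> bounds it, then
  \<open>- \<gamma>\<close> bounds \<open>x\<close> modulo \<open>B\<close>, but need not lie in the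
  kernel; since \<open>e\<close> is a cycle of the derivative, its vanishing class supplies the
  correction.\<close>

lemma homology_vanishes_ker:
  assumes sq: "subquotient \<delta> C B"
    and D: "homology_vanishes (shift \<delta>) (shift C) (deriv_sub \<delta> C B) n (p + 2)"
    and V: "homology_vanishes \<delta> C B (Suc n) (p + 1)"
  shows "homology_vanishes \<delta> (ker_sub \<delta> C B) B n p"
  unfolding homology_vanishes_def
proof (intro ballI impI)
  note S = subquotientD[OF sq]
  note fms = face_module_shift[OF S(1)]
  note gC = chains_subgrp[of C, OF S(5)] and gB = chains_subgrp[of B, OF S(6)]
  note gCs = chains_subgrp[of "shift C", OF subgrp_shift[of C, OF S(5)]]
  note gBs = chains_subgrp[of "shift B", OF subgrp_shift[of B, OF S(6)]]
  note pd = push_diff_add[of C "last_face \<delta>", OF S(5,12)]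
  note pC = push_last_face_chains[OF S(1)]
  fix x assume x: "x \<in> chains (ker_sub \<delta> C B) n p" and bx: "boundary \<delta> x \<in> chains B n (p - 1)"
  have xC: "x \<in> chains C n p"
    using chains_mono[of "ker_sub \<delta> C B" C, OF subquotient_ker(3)[OF sq]] x by blast
  have b0: "boundary (shift \<delta>) 0 = 0"
    using additive_onD(1)[OF gCs boundary_additive_on[OF fms]] .
  have "boundary \<delta> (join 0 x) = join (push (last_face \<delta>) x) (- boundary \<delta> x)"
    unfolding boundary_join b0 by simp
  then have "boundary \<delta> (join 0 x) \<in> chains B (Suc n) (p + 1 - 1)"
    using push_ker_chains[OF sq x] subgrpD(4)[OF gB bx] by (simp add: join_in_chains)
  moreover have "join 0 x \<in> chains C (Suc n) (p + 1)"
    unfolding join_in_chains using subgrpD(1)[OF gCs] xC by simp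
  ultimately obtain f where f: "f \<in> chains C (Suc n) (p + 1 + 1)" "join 0 x - boundary \<delta> f \<in> chains B (Suc n) (p + 1)"
    using homology_vanishesD[OF V] by blast
  obtain e \<gamma> where fe: "f = join e \<gamma>" and e: "e \<in> chains (shift C) n (p + 2)" and \<gamma>: "\<gamma> \<in> chains C n (p + 1)"
    using chains_Suc_cases[OF f(1)] by (metis add.assoc add_diff_cancel_right' one_add_one)
  have 1: "0 - (boundary (shift \<delta>) e + push (last_face \<delta>) \<gamma>) \<in> chains (shift B) n (p + 1)"
    and 2: "x - - boundary \<delta> \<gamma> \<in> chains B n p"
    using f(2) unfolding fe boundary_join join_add_diff join_in_chains by auto
  have n\<gamma>: "- \<gamma> \<in> chains C n (p + 1)" using subgrpD(4)[OF gC \<gamma>] .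
  have "- (0 - (boundary (shift \<delta>) e + push (last_face \<delta>) \<gamma>)) + push (last_face \<delta>) (- \<gamma>) = boundary (shift \<delta>) e"
    unfolding push_uminus[OF S(5,12) \<gamma>] by simp
  then have "boundary (shift \<delta>) e \<in> chains (deriv_sub \<delta> C B) n (p + 1)"
    using deriv_chains_join[OF sq subgrpD(4)[OF gBs 1] n\<gamma>] by metis
  then have "boundary (shift \<delta>) e \<in> chains (deriv_sub \<delta> C B) n (p + 2 - 1)" by (simp add: add.commute)
  then obtain e' where e': "e' \<in> chains (shift C) n (p + 2 + 1)" "e - boundary (shift \<delta>) e' \<in> chains (deriv_sub \<delta> C B) n (p + 2)"
    using homology_vanishesD[OF D e] by blast
  obtain \<beta> \<gamma>' where \<beta>: "\<beta> \<in> chains (shift B) n (p + 2)" and \<gamma>': "\<gamma>' \<in> chains C n (p + 2)"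
    and ee: "e - boundary (shift \<delta>) e' = \<beta> + push (last_face \<delta>) \<gamma>'"
    using deriv_chains_split[OF sq e'(2)] by blast
  have be': "boundary (shift \<delta>) e' \<in> chains (shift C) n (p + 2)"
    using boundary_mem_chains[OF fms face_module_stable[OF fms] e'(1)] by (simp add: add.commute)
  have bg: "boundary \<delta> \<gamma>' \<in> chains C n (p + 1)"
    using boundary_mem_chains[OF S(1,4) \<gamma>'] by (simp add: algebra_simps)
  have b\<beta>: "boundary (shift \<delta>) \<beta> \<in> chains (shift B) n (p + 1)"
    using boundary_mem_chains[OF fms stable_shift[OF S(2)] \<beta>] by (simp add: algebra_simps)
  have \<beta>C: "\<beta> \<in> chains (shift C) n (p + 2)"
    using chains_mono[of "shift B" "shift C"] \<beta> S(3) unfolding shift_def by blast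
  have "boundary (shift \<delta>) (e - boundary (shift \<delta>) e') = boundary (shift \<delta>) e"
    using boundary_diff[OF fms e be'] boundary_boundary[OF fms e'(1)] by simp
  moreover have "boundary (shift \<delta>) (\<beta> + push (last_face \<delta>) \<gamma>') = boundary (shift \<delta>) \<beta> + push (last_face \<delta>) (boundary \<delta> \<gamma>')"
    using boundary_linear[OF fms \<beta>C pC[OF \<gamma>']] boundary_push_last_face[OF S(1) \<gamma>'] by simp
  ultimately have b_e: "boundary (shift \<delta>) e = boundary (shift \<delta>) \<beta> + push (last_face \<delta>) (boundary \<delta> \<gamma>')"
    using ee by metis
  \<comment> \<open>Adding a boundary to \<open>- \<gamma>\<close> leaves its boundary unchanged,
    while \<open>\<gamma>'\<close> is chosen so that the last face of the result falls into
    \<open>B\<close>.\<close>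
  define \<kappa> where "\<kappa> = - \<gamma> - boundary \<delta> \<gamma>'"
  have \<kappa>C: "\<kappa> \<in> chains C n (p + 1)" unfolding \<kappa>_def by (rule subgrpD(2)[OF gC n\<gamma> bg])
  have "push (last_face \<delta>) \<kappa> = (0 - (boundary (shift \<delta>) e + push (last_face \<delta>) \<gamma>)) + boundary (shift \<delta>) \<beta>"
    unfolding \<kappa>_def pd(1)[OF n\<gamma> bg] push_uminus[OF S(5,12) \<gamma>] b_e by (simp only: algebra_simps add_minus_cancel minus_add_cancel add_0_left)
  also have "\<dots> \<in> chains (shift B) n (p + 1)" by (rule subgrpD(3)[OF gBs 1 b\<beta>])
  finally have \<kappa>: "\<kappa> \<in> chains (ker_sub \<delta> C B) n (p + 1)" by (rule ker_chains[OF \<kappa>C])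
  have "boundary \<delta> \<kappa> = - boundary \<delta> \<gamma>"
    unfolding \<kappa>_def boundary_diff[OF S(1) n\<gamma> bg] boundary_uminus[OF S(1) \<gamma>] boundary_boundary[OF S(1) \<gamma>'] by simp
  then show "\<exists>e\<in>chains (ker_sub \<delta> C B) n (p + 1). x - boundary \<delta> e \<in> chains B n p"
    using \<kappa> 2 by metis
qed

lemma homology_vanishes_out_of_range:
  assumes "subquotient \<delta> C B" "\<not> (0 \<le> i \<and> i \<le> int n)"
  shows "homology_vanishes \<delta> C B n i"
  unfolding homology_vanishes_def
proof (intro ballI impI bexI[of _ 0])
  note S = subquotientD[OF assms(1)]
  show "0 \<in> chains C n (i + 1)" using subgrpD(1)[OF chains_subgrp[of C, OF S(5)]] .
  fix x assume "x \<in> chains C n i"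
  then have "x = 0" using chains_eq_0[OF assms(2)] by blast
  moreover have "boundary \<delta> 0 = 0"
    using additive_onD(1)[OF chains_subgrp[of C, OF S(5)] boundary_additive_on[OF S(1)]] .
  ultimately show "x - boundary \<delta> 0 \<in> chains B n i"
    using subgrpD(1)[OF chains_subgrp[of B, OF S(6)]] by (metis diff_zero)
qed

section \<open>The regularity bound for Koszul homology\<close>

text \<open>The operator \<^term>\<open>\<sigma> m i\<close> stands for the transposition of the positions \<open>i\<close> and \<open>i + 1\<close>
  of an \<open>m\<close>-set.\<close>

definition symmetric_structure ::
  "(nat \<Rightarrow> nat \<Rightarrow> 'a \<Rightarrow> 'a) \<Rightarrow> (nat \<Rightarrow> nat \<Rightarrow> 'a \<Rightarrow> 'a) \<Rightarrow> (nat \<Rightarrow> 'a::ab_group_add set) \<Rightarrow> (nat \<Rightarrow> 'a set) \<Rightarrow> bool" where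
  "symmetric_structure \<sigma> \<delta> C B \<longleftrightarrow>
     (\<forall>m i. Suc i < m \<longrightarrow> additive_on (C m) (\<sigma> m i) \<and> \<sigma> m i ` C m \<subseteq> C m \<and> \<sigma> m i ` B m \<subseteq> B m) \<and>
     (\<forall>m i x. Suc i \<le> m \<longrightarrow> x \<in> C m \<longrightarrow> \<sigma> (Suc m) i (\<delta> m (Suc i) x) = \<delta> m i x) \<and>
     (\<forall>m i j x. Suc i < j \<longrightarrow> j \<le> m \<longrightarrow> x \<in> C m \<longrightarrow> \<sigma> (Suc m) i (\<delta> m j x) = \<delta> m j (\<sigma> m i x))"

text \<open>The transpositions available on the shift fix the added last point, hence commute with
  the last face and descend to its cokernel.\<close>

lemma symmetric_structure_deriv:
  assumes sq: "subquotient \<delta> C B" and sy: "symmetric_structure \<sigma> \<delta> C B"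
  shows "symmetric_structure (shift \<sigma>) (shift \<delta>) (shift C) (deriv_sub \<delta> C B)"
proof -
  note S = subquotientD[OF sq]
  have "\<sigma> (Suc m) i x \<in> deriv_sub \<delta> C B m" if i: "Suc i < m" and x: "x \<in> deriv_sub \<delta> C B m" for m i x
  proof -
    obtain b c where x: "x = b + last_face \<delta> m c" and b: "b \<in> B (Suc m)" and c: "c \<in> C m"
      using x unfolding deriv_sub_def by blast
    have bC: "b \<in> C (Suc m)" using b S(3) by blast
    have "\<sigma> (Suc m) i x = \<sigma> (Suc m) i b + \<sigma> (Suc m) i (last_face \<delta> m c)"
      using sy i bC S(10)[OF c] unfolding x symmetric_structure_def additive_on_def by simp
    also have "\<sigma> (Suc m) i (last_face \<delta> m c) = last_face \<delta> m (\<sigma> m i c)"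
      using sy i c unfolding symmetric_structure_def last_face_def by simp
    finally have "\<sigma> (Suc m) i x = \<sigma> (Suc m) i b + last_face \<delta> m (\<sigma> m i c)" .
    moreover have "\<sigma> (Suc m) i b \<in> B (Suc m)" "\<sigma> m i c \<in> C m"
      using sy i b c unfolding symmetric_structure_def image_subset_iff by simp_all
    ultimately show ?thesis unfolding deriv_sub_def by blast
  qed
  then show ?thesis
    using sy unfolding symmetric_structure_def shift_def by auto
qed

text \<open>Descending induction from the last face: the transposition of \<open>i\<close> and
  \<open>i + 1\<close> turns the face skipping \<open>i + 1\<close> into the one skipping
  \<open>i\<close>, and it preserves \<open>B\<close>. The face maps alone would not give this; it
  is why the transpositions are carried along.\<close>

lemma ker_sub_trivial:
  assumes sq: "subquotient \<delta> C B" and sy: "symmetric_structure \<sigma> \<delta> C B"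
    and x: "x \<in> ker_sub \<delta> C B m" and j: "j \<le> m"
  shows "\<delta> m j x \<in> B (Suc m)"
  using j
proof (induction j rule: inc_induct)
  case base
  then show ?case using x by (simp add: ker_sub_def last_face_def)
next
  case (step i)
  have "x \<in> C m" using x by (simp add: ker_sub_def)
  then show ?case
    using step sy unfolding symmetric_structure_def by (metis Suc_leI Suc_less_eq image_subset_iff)
qed

text \<open>Serves to show that the Koszul complex of a module on which all faces act by zero has
  zero differential.\<close>

lemma boundary_lower:
  assumes "stable \<delta> A" "face_module \<delta> C" "\<And>m. A m \<subseteq> C m" "\<And>m. subgrp (B m)"
    and "\<And>m j x. j \<le> m \<Longrightarrow> x \<in> A m \<Longrightarrow> \<delta> m j x \<in> B (Suc m)"
    and "c \<in> chains A n i"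
  shows "boundary \<delta> c \<in> chains B n (i - 1)"
  using assms
proof (induction n arbitrary: A B C \<delta> c i)
  case 0
  have "boundary \<delta> c = 0"
    using boundary_degree_0[OF 0(6)] face_module_0[OF 0(2)] by blast
  then show ?case using subgrpD(1)[OF chains_subgrp[of B, OF 0(4)]] by metis
next
  case (Suc n)
  obtain a b where c: "c = join a b" and a: "a \<in> chains (shift A) n i" and b: "b \<in> chains A n (i - 1)"
    using chains_Suc_cases[OF Suc.prems(6)] by blast
  have "boundary (shift \<delta>) a \<in> chains (shift B) n (i - 1)"
    by (rule Suc.IH[OF stable_shift[OF Suc.prems(1)] face_module_shift[OF Suc.prems(2)] _ _ _ a])
      (auto simp: shift_def Suc.prems Suc.prems(3)[THEN subsetD])
  moreover have "push (last_face \<delta>) b \<in> chains (shift B) n (i - 1)"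
    using Suc.prems(5) last_face_props(2)[OF Suc.prems(2)]
    by (intro push_chains[OF _ _ b]) (auto simp: last_face_def shift_def)
  moreover have "boundary \<delta> b \<in> chains B n (i - 1 - 1)"
    by (rule Suc.IH[OF Suc.prems(1-5) b])
  ultimately show ?case
    unfolding c boundary_join join_in_chains
    using subgrpD(3)[OF chains_subgrp[of "shift B", OF subgrp_shift[of B, OF Suc.prems(4)]]]
      subgrpD(4)[OF chains_subgrp[of B, OF Suc.prems(4)]] by blast
qed

text \<open>The list without \<open>True\<close> encodes the empty subset, so this identifies chains
  of homological degree 0 with elements of degree \<open>n\<close>.\<close>

definition single :: "nat \<Rightarrow> 'a \<Rightarrow> bool list \<Rightarrow> 'a::zero" where
  "single n x l = (if l = replicate n False then x else 0)"

lemma count_list_replicate: "count_list (replicate n x) y = (if x = y then n else 0)"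
  by (induction n) auto

lemma nT_0_iff: "nT l = 0 \<longleftrightarrow> l = replicate (length l) False"
  by (induction l) auto

lemma single_in_chains: "single n x \<in> chains C n 0 \<longleftrightarrow> x \<in> C n"
proof
  assume "single n x \<in> chains C n 0"
  then show "x \<in> C n" using chainsD(1)[of "single n x" C n 0 "replicate n False"]
    by (simp add: single_def count_list_replicate)
next
  assume "x \<in> C n"
  then show "single n x \<in> chains C n 0"
    using nT_0_iff by (intro chainsI) (auto simp: single_def count_list_replicate)
qed

lemma chains_0_single:
  assumes "c \<in> chains C n 0"
  shows "c = single n (c (replicate n False))"
proof
  fix l show "c l = single n (c (replicate n False)) l"
    using chainsD(2)[OF assms, of l] nT_0_iff[of l] by (auto simp: single_def count_list_replicate)
qed

text \<open>Homological degree \<open>i\<close> involves the module only in degree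
  \<open>n - i\<close>; if the quotient is zero there, every chain is already zero modulo
  \<open>B\<close>.\<close>

lemma homology_vanishes_eq:
  assumes "subquotient \<delta> C B" "C (n - nat i) = B (n - nat i)"
  shows "homology_vanishes \<delta> C B n i"
proof (cases "0 \<le> i \<and> i \<le> int n")
  case False
  then show ?thesis by (rule homology_vanishes_out_of_range[OF assms(1)])
next
  case True
  note S = subquotientD[OF assms(1)]
  have eq: "x \<in> chains B n i" if x: "x \<in> chains C n i" for x
  proof (rule chainsI)
    fix l assume l: "length l = n" "int (nT l) = i"
    then have "nF l = n - nat i" using nT_nF[of l] by linarith
    then show "x l \<in> B (nF l)" using chainsD(1)[OF x l] assms(2) by simp
  qed (rule chainsD(2)[OF x])
  have "boundary \<delta> 0 = 0"
    using additive_onD(1)[OF chains_subgrp[of C, OF S(5)] boundary_additive_on[OF S(1)]] .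
  then show ?thesis unfolding homology_vanishes_def
    using eq subgrpD(1)[OF chains_subgrp[of C, OF S(5)]] by (metis diff_zero)
qed

text \<open>The differential of the kernel complex is zero modulo \<open>B\<close>, so its homology
  in degree 0 is the kernel itself, with nothing divided out.\<close>

lemma ker_sub_eq:
  assumes sq: "subquotient \<delta> C B" and sy: "symmetric_structure \<sigma> \<delta> C B"
    and H: "homology_vanishes \<delta> (ker_sub \<delta> C B) B n 0"
  shows "ker_sub \<delta> C B n = B n"
proof
  note S = subquotientD[OF sq]
  note K = subquotient_ker[OF sq]
  show "B n \<subseteq> ker_sub \<delta> C B n" by (rule K(2))
  show "ker_sub \<delta> C B n \<subseteq> B n"
  proof
    fix x assume x: "x \<in> ker_sub \<delta> C B n"
    note bl = boundary_lower[OF K(1) S(1) K(3) S(6) ker_sub_trivial[OF sq sy]]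
    have s: "single n x \<in> chains (ker_sub \<delta> C B) n 0" using x by (simp add: single_in_chains)
    then obtain e where e: "e \<in> chains (ker_sub \<delta> C B) n (0 + 1)" "single n x - boundary \<delta> e \<in> chains B n 0"
      using homology_vanishesD[OF H s] bl by blast
    have "boundary \<delta> e \<in> chains B n 0" using bl[OF _ _ e(1)] by simp
    then have "single n x - boundary \<delta> e + boundary \<delta> e \<in> chains B n 0"
      using e(2) subgrpD(3)[OF chains_subgrp[of B, OF S(6)]] by blast
    then show "x \<in> B n" using single_in_chains[of n x B] by simp
  qed
qed

text \<open>A graded Nakayama lemma: a boundary in degree \<open>n\<close> uses only smaller
  degrees, where the quotient is zero by induction.\<close>

lemma homology_0_eq:
  assumes sq: "subquotient \<delta> C B" and H: "\<And>n. homology_vanishes \<delta> C B n 0"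
  shows "C n = B n"
proof (induction n rule: less_induct)
  case (less n)
  note S = subquotientD[OF sq]
  have "x \<in> B n" if x: "x \<in> C n" for x
  proof -
    have s: "single n x \<in> chains C n 0" using x by (simp add: single_in_chains)
    have "boundary \<delta> (single n x) \<in> chains C n (0 - 1)" by (rule boundary_mem_chains[OF S(1,4) s])
    then have "boundary \<delta> (single n x) = 0" using chains_eq_0[of "0 - 1" n C] by auto
    then have "boundary \<delta> (single n x) \<in> chains B n (0 - 1)"
      using subgrpD(1)[OF chains_subgrp[of B, OF S(6)]] by metis
    then obtain e where e: "e \<in> chains C n (0 + 1)" "single n x - boundary \<delta> e \<in> chains B n 0"
      using homology_vanishesD[OF H s] by blast
    have "e \<in> chains B n (0 + 1)"
    proof (rule chainsI)
      fix l assume l: "length l = n" "int (nT l) = 0 + 1"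
      then have "nF l < n" using nT_nF[of l] by linarith
      then show "e l \<in> B (nF l)" using chainsD(1)[OF e(1) l] less by simp
    qed (rule chainsD(2)[OF e(1)])
    then have "boundary \<delta> e \<in> chains B n 0" using boundary_mem_chains[OF S(1,2)] by fastforce
    then have "single n x - boundary \<delta> e + boundary \<delta> e \<in> chains B n 0"
      using e(2) subgrpD(3)[OF chains_subgrp[of B, OF S(6)]] by blast
    then show ?thesis using single_in_chains[of n x B] by simp
  qed
  then show ?case using S(3) by blast
qed

text \<open>The degree of generation is at most \<open>e - 1\<close>; the offset lets the induction start from the
  zero module.\<close>

theorem regularity_bound:
  assumes "subquotient \<delta> C B" "symmetric_structure \<sigma> \<delta> C B"
    and "\<And>n. e \<le> n \<Longrightarrow> homology_vanishes \<delta> C B n 0"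
    and "\<And>n. r < n \<Longrightarrow> homology_vanishes \<delta> C B n 1"
    and "1 \<le> i" "i + int r + min (int r) (int e - 1) - 1 < int n"
  shows "homology_vanishes \<delta> C B n i"
  using assms
proof (induction e arbitrary: \<sigma> \<delta> C B r n i)
  case 0
  then show ?case using homology_0_eq[OF 0(1)] by (intro homology_vanishes_eq) auto
next
  case (Suc e)
  note sq = Suc.prems(1) and sy = Suc.prems(2)
  note S = subquotientD[OF sq]
  note sqD = subquotient_deriv[OF sq]
  \<comment> \<open>The regularity bound claimed for \<open>V\<close>. If \<open>r\<close> is
    positive, the induction hypothesis gives the derivative the bound \<open>s - 2\<close>.\<close>
  define s where "s = int r + min (int r) (int e) - 1"
  have D: "homology_vanishes (shift \<delta>) (shift C) (deriv_sub \<delta> C B) n i"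
    if "1 \<le> i" "i + s - 1 \<le> int n \<or> i + s - 1 < int n" for n i
  \<comment> \<open>The natural number \<open>r - 1\<close> does not drop when \<open>r = 0\<close>.
    Then the induction hypothesis asks at most for \<open>i - 1 < n\<close>, and the remaining range
    \<open>n < i\<close> has no chains.\<close>
  proof (cases "int n < i")
    case True
    then show ?thesis using homology_vanishes_out_of_range[OF sqD] by simp
  next
    case False
    show ?thesis
    proof (rule Suc.IH[OF sqD symmetric_structure_deriv[OF sq sy], of "r - 1"])
      show "homology_vanishes (shift \<delta>) (shift C) (deriv_sub \<delta> C B) n 0" if "e \<le> n" for n
        using homology_vanishes_deriv[OF sq] Suc.prems(3)[of "Suc n"] that by simp
      show "homology_vanishes (shift \<delta>) (shift C) (deriv_sub \<delta> C B) n 1" if "r - 1 < n" for n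
        using homology_vanishes_deriv[OF sq] Suc.prems(4)[of "Suc n"] that by simp
      show "1 \<le> i" by fact
      show "i + int (r - 1) + min (int (r - 1)) (int e - 1) - 1 < int n"
        using that False unfolding s_def by (cases r) auto
    qed
  qed
  \<comment> \<open>The two terms bounding the kernel: the second homology of the derivative
    vanishes in degree \<open>n\<close> because \<open>2 + s - 1 \<le> n\<close>, and the first
    homology of \<open>V\<close> in degree \<open>n + 1\<close> because
    \<open>r \<le> r + min r e = s + 1 \<le> n\<close>.\<close>
  have K: "ker_sub \<delta> C B n = B n" if "s + 1 \<le> int n" for n
  proof (rule ker_sub_eq[OF sq sy])
    have "homology_vanishes (shift \<delta>) (shift C) (deriv_sub \<delta> C B) n (0 + 2)"
      using D[of "0 + 2" n] that by simp
    moreover have "homology_vanishes \<delta> C B (Suc n) (0 + 1)"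
      using Suc.prems(4)[of "Suc n"] that unfolding s_def by (auto simp: min_def split: if_splits)
    ultimately show "homology_vanishes \<delta> (ker_sub \<delta> C B) B n 0"
      by (rule homology_vanishes_ker[OF sq])
  qed
  have n: "i + s < int n" using Suc.prems(6) unfolding s_def by simp
  show ?case
  proof (cases n)
    case 0
    then show ?thesis using homology_vanishes_out_of_range[OF sq] Suc.prems(5) by simp
  next
    case (Suc m)
    show ?thesis unfolding Suc
    proof (rule homology_vanishes_shift_deriv[OF sq])
      show "homology_vanishes (shift \<delta>) (shift C) (deriv_sub \<delta> C B) m i"
        using D Suc.prems(5) n Suc by simp
      show "homology_vanishes \<delta> (ker_sub \<delta> C B) B m (i - 1)"
      proof (cases "i - 1 \<le> int m")
        case True
        \<comment> \<open>Homological degree \<open>i - 1\<close> over \<open>m\<close> points sees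
          the kernel only in degree \<open>m - (i - 1) = n - i\<close>, which exceeds
          \<open>s\<close>.\<close>
        then have "s + 1 \<le> int (m - nat (i - 1))" using n Suc Suc.prems(5) by auto
        then show ?thesis using homology_vanishes_eq[OF subquotient_ker_sub[OF sq] K] by blast
      next
        case False
        then show ?thesis using homology_vanishes_out_of_range[OF subquotient_ker_sub[OF sq]] by simp
      qed
    qed
  qed
qed

section \<open>Face maps of FI_G-modules\<close>

text \<open>Position \<open>j\<close>, counted from 0, is the element \<open>Suc j\<close> of
  \<open>{1..Suc m}\<close>, and that is the element missed. All labels are 0.\<close>

definition face :: "nat \<Rightarrow> nat \<Rightarrow> (nat \<Rightarrow> nat) \<times> (nat \<Rightarrow> 'g::group_add)" where
  "face m j = (\<lambda>x. if x \<in> {1..m} then (if x \<le> j then x else Suc x) else 0, \<lambda>x. 0)"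

definition swap :: "nat \<Rightarrow> nat \<Rightarrow> (nat \<Rightarrow> nat) \<times> (nat \<Rightarrow> 'g::group_add)" where
  "swap m i = (\<lambda>x. if x \<in> {1..m} then (if x = Suc i then Suc (Suc i) else if x = Suc (Suc i) then Suc i else x) else 0, \<lambda>x. 0)"

lemma HomD:
  assumes "\<phi> \<in> Hom n m"
  shows "x \<in> {1..n} \<Longrightarrow> fst \<phi> x \<in> {1..m}" "x \<notin> {1..n} \<Longrightarrow> fst \<phi> x = 0" "x \<notin> {1..n} \<Longrightarrow> snd \<phi> x = 0"
proof -
  have "fst \<phi> ` {1..n} \<subseteq> {1..m}" "\<forall>x. x \<notin> {1..n} \<longrightarrow> fst \<phi> x = 0 \<and> snd \<phi> x = 0"
    using assms unfolding Hom_def case_prod_beta mem_Collect_eq by blast+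
  then show "x \<in> {1..n} \<Longrightarrow> fst \<phi> x \<in> {1..m}" "x \<notin> {1..n} \<Longrightarrow> fst \<phi> x = 0" "x \<notin> {1..n} \<Longrightarrow> snd \<phi> x = 0"
    by blast+
qed

lemma face_Hom: "face m j \<in> Hom m (Suc m)"
  unfolding face_def Hom_def by (auto simp: inj_on_def split: if_splits)

lemma swap_Hom: "Suc i < m \<Longrightarrow> swap m i \<in> Hom m m"
  unfolding swap_def Hom_def by (auto simp: inj_on_def split: if_splits)

lemma hom_comp_Hom: "\<phi> \<in> Hom n m \<Longrightarrow> \<psi> \<in> Hom m p \<Longrightarrow> hom_comp n \<psi> \<phi> \<in> Hom n p"
proof (cases \<phi>; cases \<psi>)
  fix f g f' g' assume fg: "\<phi> = (f, g)" "\<psi> = (f', g')"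
  assume "\<phi> \<in> Hom n m" "\<psi> \<in> Hom m p"
  then have f: "f ` {1..n} \<subseteq> {1..m}" "inj_on f {1..n}" and f': "f' ` {1..m} \<subseteq> {1..p}" "inj_on f' {1..m}"
    unfolding fg Hom_def by simp_all
  define h where "h x = (if x \<in> {1..n} then f' (f x) else 0)" for x
  have "inj_on (f' \<circ> f) {1..n}" using comp_inj_on[OF f(2)] inj_on_subset[OF f'(2) f(1)] by blast
  moreover have "inj_on (f' \<circ> f) {1..n} \<longleftrightarrow> inj_on h {1..n}"
    by (rule inj_on_cong) (simp add: h_def)
  ultimately have "inj_on h {1..n}" by blast
  moreover have "h ` {1..n} \<subseteq> {1..p}"
    using f(1) f'(1) unfolding h_def image_subset_iff by simp
  moreover have "hom_comp n \<psi> \<phi> = (h, \<lambda>x. if x \<in> {1..n} then g x + g' (f x) else 0)"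
    unfolding fg hom_comp_def h_def by (simp add: fun_eq_iff)
  ultimately show "hom_comp n \<psi> \<phi> \<in> Hom n p"
    unfolding Hom_def h_def by simp
qed

lemma face_face:
  "i \<le> j \<Longrightarrow> j \<le> m \<Longrightarrow> hom_comp m (face (Suc m) (Suc j)) (face m i) = hom_comp m (face (Suc m) i) (face m j)"
  unfolding hom_comp_def face_def by (auto simp: fun_eq_iff)

lemma swap_face: "Suc i \<le> m \<Longrightarrow> hom_comp m (swap (Suc m) i) (face m (Suc i)) = face m i"
  unfolding hom_comp_def face_def swap_def by (auto simp: fun_eq_iff)

lemma swap_face_commute:
  "Suc i < j \<Longrightarrow> j \<le> m \<Longrightarrow> hom_comp m (swap (Suc m) i) (face m j) = hom_comp m (face m j) (swap m i)"
  unfolding hom_comp_def face_def swap_def by (auto simp: fun_eq_iff)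

text \<open>Closing the gap at \<open>Suc j\<close> gives the underlying injection of the factor. As
  faces have label 0, the factor keeps the labels of the given morphism.\<close>

lemma Hom_factor:
  assumes "\<phi> \<in> Hom n (Suc m)" "j \<le> m" "Suc j \<notin> fst \<phi> ` {1..n}"
  obtains \<psi> where "\<psi> \<in> Hom n m" "hom_comp n (face m j) \<psi> = \<phi>"
proof -
  obtain f g where \<phi>: "\<phi> = (f, g)" by force
  define h where "h x = (if x \<in> {1..n} then (if f x \<le> j then f x else f x - 1) else 0)" for x
  have im: "f ` {1..n} \<subseteq> {1..Suc m}" and inj: "inj_on f {1..n}"
    and out: "\<And>x. x \<notin> {1..n} \<Longrightarrow> f x = 0 \<and> g x = 0"
    using assms(1) unfolding \<phi> Hom_def by simp_all
  have h: "h x \<in> {1..m} \<and> (if h x \<le> j then h x else Suc (h x)) = f x" if x: "x \<in> {1..n}" for x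
  proof -
    have "f x \<in> {1..Suc m}" using im x by blast
    moreover have "f x \<noteq> Suc j" using assms(3) x unfolding \<phi> by (metis fst_conv imageI)
    ultimately show ?thesis using x assms(2) by (simp add: h_def; linarith)
  qed
  have "inj_on ((\<lambda>y. if y \<le> j then y else Suc y) \<circ> h) {1..n} \<longleftrightarrow> inj_on f {1..n}"
    by (rule inj_on_cong) (use h in simp)
  then have "inj_on h {1..n}" using inj inj_on_imageI2 by blast
  moreover have "h ` {1..n} \<subseteq> {1..m}" using h by blast
  moreover have "h x = 0 \<and> g x = 0" if "x \<notin> {1..n}" for x
    unfolding h_def using that out[OF that] by presburger
  ultimately have hg: "(h, g) \<in> Hom n m"
    unfolding Hom_def by blast
  have "fst (hom_comp n (face m j) (h, g)) x = f x" for x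
    using h[of x] out[of x] by (simp add: hom_comp_def face_def)
  moreover have "snd (hom_comp n (face m j) (h, g)) x = g x" for x
    using out[of x] by (simp add: hom_comp_def face_def)
  ultimately have "hom_comp n (face m j) (h, g) = \<phi>"
    unfolding \<phi> by (simp add: prod_eq_iff fun_eq_iff)
  with hg show ?thesis by (rule that)
qed

definition face_act where
  "face_act act m j = act m (Suc m) (face m j)"

definition swap_act where
  "swap_act act m i = act m m (swap m i)"

lemma fig_moduleD:
  assumes "fig_module sc C act"
  shows "module sc" "module.subspace sc (C n)"
    "\<And>\<phi> x. \<phi> \<in> Hom n m \<Longrightarrow> x \<in> C n \<Longrightarrow> act n m \<phi> x \<in> C m"
    "\<And>\<phi>. \<phi> \<in> Hom n m \<Longrightarrow> additive_on (C n) (act n m \<phi>)"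
    "\<And>\<phi> x c. \<phi> \<in> Hom n m \<Longrightarrow> x \<in> C n \<Longrightarrow> act n m \<phi> (sc c x) = sc c (act n m \<phi> x)"
    "\<And>\<phi> \<psi> x p. \<phi> \<in> Hom n m \<Longrightarrow> \<psi> \<in> Hom m p \<Longrightarrow> x \<in> C n \<Longrightarrow> act n p (hom_comp n \<psi> \<phi>) x = act m p \<psi> (act n m \<phi> x)"
  using assms unfolding fig_module_def additive_on_def by blast+

lemma subspace_subgrp:
  assumes "module sc" "module.subspace sc A"
  shows "subgrp A"
proof -
  interpret module sc by fact
  show ?thesis unfolding subgrp_def using subspace_0 subspace_diff assms(2) by blast
qed

lemma fig_face_module:
  assumes "fig_module sc C act"
  shows "face_module (face_act act) C"
proof -
  note F = fig_moduleD[OF assms]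
  have "face_act act (Suc m) (Suc j) (face_act act m i x) = face_act act (Suc m) i (face_act act m j x)"
    if "i \<le> j" "j \<le> m" "x \<in> C m" for m i j x
    unfolding face_act_def
    using F(6)[OF face_Hom face_Hom that(3)] face_face[OF that(1,2)] by metis
  then show ?thesis
    unfolding face_module_def stable_def
    using subspace_subgrp[OF F(1,2)] F(3,4)[OF face_Hom] by (simp add: face_act_def)
qed

lemma fig_symmetric:
  assumes "fig_module sc C act"
    and B: "\<And>m i x. Suc i < m \<Longrightarrow> x \<in> B m \<Longrightarrow> swap_act act m i x \<in> B m"
  shows "symmetric_structure (swap_act act) (face_act act) C B"
proof -
  note F = fig_moduleD[OF assms(1)]
  have "swap_act act (Suc m) i (face_act act m (Suc i) x) = face_act act m i x" if "Suc i \<le> m" "x \<in> C m" for m i x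
    using F(6)[OF face_Hom swap_Hom that(2), of i "Suc i"] that(1)
    unfolding face_act_def swap_act_def by (simp add: swap_face)
  moreover have "swap_act act (Suc m) i (face_act act m j x) = face_act act m j (swap_act act m i x)"
    if "Suc i < j" "j \<le> m" "x \<in> C m" for m i j x
    unfolding face_act_def swap_act_def
    using F(6)[OF face_Hom swap_Hom that(3), of i j] F(6)[OF swap_Hom face_Hom that(3), of i j] that
    by (simp add: swap_face_commute)
  ultimately show ?thesis
    using F(3,4)[OF swap_Hom] B unfolding symmetric_structure_def by (auto simp: swap_act_def)
qed

section \<open>Koszul homology in degree zero and the images from lower degrees\<close>

text \<open>For \<open>n = 0\<close> the sum is empty, so the truncation of \<open>n - 1\<close>
  does no harm.\<close>

definition face_sums :: "(nat \<Rightarrow> nat \<Rightarrow> 'a \<Rightarrow> 'a) \<Rightarrow> (nat \<Rightarrow> 'a::ab_group_add set) \<Rightarrow> nat \<Rightarrow> 'a set" where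
  "face_sums \<delta> A n = {\<Sum>j<n. \<delta> (n - 1) j (y j) |y. \<forall>j<n. y j \<in> A (n - 1)}"

lemma face_sumsI:
  "x = (\<Sum>j<n. \<delta> (n - 1) j (y j)) \<Longrightarrow> (\<And>j. j < n \<Longrightarrow> y j \<in> A (n - 1)) \<Longrightarrow> x \<in> face_sums \<delta> A n"
  unfolding face_sums_def by blast

text \<open>Splitting off the last face mirrors the cone description of the differential and allows
  the same induction.\<close>

lemma face_sums_Suc:
  "x \<in> face_sums \<delta> A (Suc n) \<longleftrightarrow> (\<exists>y\<in>A n. x - \<delta> n n y \<in> face_sums (shift \<delta>) (shift A) n)"
proof
  assume "x \<in> face_sums \<delta> A (Suc n)"
  then obtain y where y: "\<forall>j<Suc n. y j \<in> A n" "x = (\<Sum>j<Suc n. \<delta> n j (y j))"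
    unfolding face_sums_def by auto
  then have "x - \<delta> n n (y n) = (\<Sum>j<n. \<delta> n j (y j))" by simp
  also have "\<dots> = (\<Sum>j<n. shift \<delta> (n - 1) j (y j))"
    by (cases n) (simp_all add: shift_def)
  finally show "\<exists>y\<in>A n. x - \<delta> n n y \<in> face_sums (shift \<delta>) (shift A) n"
    using y unfolding face_sums_def shift_def by (intro bexI[of _ "y n"]) (cases n; auto)+
next
  assume "\<exists>y\<in>A n. x - \<delta> n n y \<in> face_sums (shift \<delta>) (shift A) n"
  then obtain z y where z: "z \<in> A n" and y: "\<forall>j<n. y j \<in> shift A (n - 1)"
    and x: "x - \<delta> n n z = (\<Sum>j<n. shift \<delta> (n - 1) j (y j))"
    unfolding face_sums_def by auto
  have "(\<Sum>j<n. shift \<delta> (n - 1) j (y j)) = (\<Sum>j<n. \<delta> n j ((y(n := z)) j))"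
    by (cases n) (auto simp: shift_def intro!: sum.cong)
  then have "x = (\<Sum>j<Suc n. \<delta> (Suc n - 1) j ((y(n := z)) j))" using x by (simp add: algebra_simps)
  moreover have "\<forall>j<Suc n. (y(n := z)) j \<in> A (Suc n - 1)"
    using y z by (cases n) (auto simp: shift_def less_Suc_eq)
  ultimately show "x \<in> face_sums \<delta> A (Suc n)" unfolding face_sums_def by blast
qed

lemma join_single: "single (Suc n) x = join (single n x) 0"
  by (auto simp: single_def join_def fun_eq_iff split: list.split)

lemma push_single: "(\<And>m. f m 0 = 0) \<Longrightarrow> push f (single n y) = single n (f n y)"
  by (auto simp: single_def push_def fun_eq_iff count_list_replicate)

lemma single_inject [simp]: "single n x = single n y \<longleftrightarrow> x = y"
  by (auto simp: single_def fun_eq_iff)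

lemma single_add_diff: "single n (x + y) = single n x + single n (y::'a::ab_group_add)"
  "single n (x - y) = single n x - single n y"
  by (auto simp: single_def fun_eq_iff)

lemma join_inject [simp]: "join a b = join a' b' \<longleftrightarrow> a = a' \<and> b = b'"
proof
  assume j: "join a b = join a' b'"
  have "a l = a' l" "b l = b' l" for l
    using fun_cong[OF j, of "False # l"] fun_cong[OF j, of "True # l"] by (simp_all add: join_def)
  then show "a = a' \<and> b = b'" by auto
qed simp

lemma boundary_chains_0:
  assumes "face_module \<delta> C" "c \<in> chains C n 0"
  shows "boundary \<delta> c = 0"
  using boundary_mem_chains[OF assms(1) face_module_stable[OF assms(1)] assms(2)] chains_eq_0[of "0 - 1" n C] by auto

text \<open>A chain of degree 1 has one coefficient per omitted point, and its boundary is the sum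
  of the corresponding faces. Thus Koszul homology in degree 0 is the quotient by face sums.\<close>

lemma boundary_chains_1:
  assumes "face_module \<delta> C"
  shows "(\<exists>e\<in>chains C n 1. boundary \<delta> e = single n x) \<longleftrightarrow> x \<in> face_sums \<delta> C n"
  using assms
proof (induction n arbitrary: \<delta> C x)
  case 0
  note g = chains_subgrp[of C, OF face_module_subgrp[OF 0]]
  have "boundary \<delta> 0 = 0" by (rule additive_onD(1)[OF g boundary_additive_on[OF 0]])
  moreover have "chains C 0 1 = {0}" using chains_eq_0[of 1 0 C] subgrpD(1)[OF g] by auto
  moreover have "single 0 x = 0 \<longleftrightarrow> x = 0" by (auto simp: single_def fun_eq_iff)
  moreover have "face_sums \<delta> C 0 = {0}" by (simp add: face_sums_def)
  ultimately show ?case by (metis singleton_iff)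
next
  case (Suc n)
  note fm = Suc.prems
  show ?case
  proof
    assume "\<exists>e\<in>chains C (Suc n) 1. boundary \<delta> e = single (Suc n) x"
    then obtain e where e: "e \<in> chains C (Suc n) 1" "boundary \<delta> e = single (Suc n) x" by blast
    obtain a b where ab: "e = join a b" and a: "a \<in> chains (shift C) n 1" and b: "b \<in> chains C n 0"
      using chains_Suc_cases[OF e(1)] by auto
    define y where "y = b (replicate n False)"
    have bs: "b = single n y" unfolding y_def by (rule chains_0_single[OF b])
    have y: "y \<in> C n" using b unfolding bs single_in_chains .
    have "boundary (shift \<delta>) a + push (last_face \<delta>) b = single n x"
      using e(2) unfolding ab boundary_join join_single by simp
    then have "boundary (shift \<delta>) a = single n (x - \<delta> n n y)"
      unfolding bs push_single[of "last_face \<delta>", OF last_face_props(2)[OF fm]] single_add_diff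
      by (simp add: last_face_def eq_diff_eq)
    then show "x \<in> face_sums \<delta> C (Suc n)"
      unfolding face_sums_Suc using Suc.IH[OF face_module_shift[OF fm], of "x - \<delta> n n y"] a y by blast
  next
    assume "x \<in> face_sums \<delta> C (Suc n)"
    then obtain y where y: "y \<in> C n" and "x - \<delta> n n y \<in> face_sums (shift \<delta>) (shift C) n"
      unfolding face_sums_Suc by blast
    then obtain a where a: "a \<in> chains (shift C) n 1" "boundary (shift \<delta>) a = single n (x - \<delta> n n y)"
      using Suc.IH[OF face_module_shift[OF fm], of "x - \<delta> n n y"] by blast
    have s: "single n y \<in> chains C n 0" using y by (simp add: single_in_chains)
    have "boundary \<delta> (join a (single n y)) = single (Suc n) x"
      unfolding boundary_join boundary_chains_0[OF fm s] a(2) join_single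
        push_single[of "last_face \<delta>", OF last_face_props(2)[OF fm]]
      by (simp add: last_face_def single_add_diff)
    moreover have "join a (single n y) \<in> chains C (Suc n) 1"
      unfolding join_in_chains using a(1) s by simp
    ultimately show "\<exists>e\<in>chains C (Suc n) 1. boundary \<delta> e = single (Suc n) x" by blast
  qed
qed

lemma homology_0_vanishes:
  assumes "subquotient \<delta> C B" "\<And>x. x \<in> C n \<Longrightarrow> \<exists>y\<in>face_sums \<delta> C n. x - y \<in> B n"
  shows "homology_vanishes \<delta> C B n 0"
  unfolding homology_vanishes_def
proof (intro ballI impI)
  fix c assume "c \<in> chains C n 0"
  then obtain x where c: "c = single n x" and x: "x \<in> C n"
    using chains_0_single single_in_chains by metis
  obtain y where "y \<in> face_sums \<delta> C n" and xy: "x - y \<in> B n" using assms(2)[OF x] by blast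
  then obtain e where "e \<in> chains C n 1" "boundary \<delta> e = single n y"
    using boundary_chains_1[OF subquotientD(1)[OF assms(1)]] by metis
  then show "\<exists>e\<in>chains C n (0 + 1). c - boundary \<delta> e \<in> chains B n 0"
    using xy by (intro bexI[of _ e]) (simp_all add: c flip: single_add_diff single_in_chains)
qed

text \<open>A morphism from a smaller degree misses a point and therefore factors through a face.
  The face sums already form a submodule, so taking the span adds nothing.\<close>

lemma fig_lower_eq:
  fixes act :: "nat \<Rightarrow> nat \<Rightarrow> (nat \<Rightarrow> nat) \<times> (nat \<Rightarrow> 'g::group_add) \<Rightarrow> 'v::ab_group_add \<Rightarrow> 'v"
  assumes "fig_module sc C act"
  shows "lower sc C act n = face_sums (face_act act) C n"
proof
  note F = fig_moduleD[OF assms]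
  interpret module sc by (rule F(1))
  let ?G = "\<Union>m\<in>{..<n}. \<Union>\<phi>\<in>Hom m n. act m n \<phi> ` C m"
  have fa: "additive_on (C m) (face_act act m j)" for m j
    unfolding face_act_def by (rule F(4)[OF face_Hom])
  note gC = subspace_subgrp[OF F(1,2)]
  have sub: "subspace (face_sums (face_act act) C n)"
  proof (rule subspaceI)
    have "0 = (\<Sum>j<n. face_act act (n - 1) j 0)" using additive_onD(1)[OF gC fa] by simp
    then show "0 \<in> face_sums (face_act act) C n"
      using subgrpD(1)[OF gC] by (rule face_sumsI)
  next
    fix x x' assume "x \<in> face_sums (face_act act) C n" "x' \<in> face_sums (face_act act) C n"
    then obtain y y' where y: "\<forall>j<n. y j \<in> C (n - 1)" "\<forall>j<n. y' j \<in> C (n - 1)"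
      and x: "x = (\<Sum>j<n. face_act act (n - 1) j (y j))" "x' = (\<Sum>j<n. face_act act (n - 1) j (y' j))"
      unfolding face_sums_def by blast
    have "x + x' = (\<Sum>j<n. face_act act (n - 1) j (y j + y' j))"
      unfolding x sum.distrib[symmetric] using additive_onD(2)[OF gC fa] y by (intro sum.cong) auto
    then show "x + x' \<in> face_sums (face_act act) C n"
      by (rule face_sumsI) (use y subgrpD(3)[OF gC] in blast)
  next
    fix c x assume "x \<in> face_sums (face_act act) C n"
    then obtain y where y: "\<forall>j<n. y j \<in> C (n - 1)"
      and x: "x = (\<Sum>j<n. face_act act (n - 1) j (y j))"
      unfolding face_sums_def by blast
    have "face_act act m j (sc c z) = sc c (face_act act m j z)" if "z \<in> C m" for m j z
      unfolding face_act_def by (rule F(5)[OF face_Hom that])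
    then have "sc c x = (\<Sum>j<n. face_act act (n - 1) j (sc c (y j)))"
      unfolding x scale_sum_right using y by (intro sum.cong) auto
    then show "sc c x \<in> face_sums (face_act act) C n"
      by (rule face_sumsI) (use y subspace_scale[OF F(2)] in blast)
  qed
  have "?G \<subseteq> face_sums (face_act act) C n"
  proof safe
    fix m x and f :: "nat \<Rightarrow> nat" and g :: "nat \<Rightarrow> 'g"
    assume m: "m < n" and fg: "(f, g) \<in> Hom m n" and x: "x \<in> C m"
    obtain n' where n': "n = Suc n'" using m by (cases n) auto
    have "card (f ` {1..m}) < card {1..n}"
      using m card_image_le[of "{1..m}" f] by simp
    then obtain q where "q \<in> {1..n}" "q \<notin> f ` {1..m}"
      using card_mono[of "f ` {1..m}" "{1..n}"] by (meson finite_atLeastAtMost finite_imageI not_le subsetI)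
    then obtain j where j: "j \<le> n'" "Suc j \<notin> fst (f, g) ` {1..m}"
      using n' by (cases q) auto
    obtain \<psi> where \<psi>: "\<psi> \<in> Hom m n'" "hom_comp m (face n' j) \<psi> = (f, g)"
      using Hom_factor[OF fg[unfolded n'] j] by blast
    define y where "y i = (if i = j then act m n' \<psi> x else 0)" for i
    have "act m n (f, g) x = face_act act n' j (act m n' \<psi> x)"
      using F(6)[OF \<psi>(1) face_Hom x, of j] \<psi>(2) by (simp add: face_act_def n')
    also have "\<dots> = (\<Sum>i<n. if i = j then face_act act n' j (act m n' \<psi> x) else 0)"
      using j n' by simp
    also have "\<dots> = (\<Sum>i<n. face_act act (n - 1) i (y i))"
      using additive_onD(1)[OF gC fa] by (intro sum.cong) (auto simp: n' y_def)
    finally have "act m n (f, g) x = (\<Sum>i<n. face_act act (n - 1) i (y i))" .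
    then show "act m n (f, g) x \<in> face_sums (face_act act) C n"
      by (rule face_sumsI) (use F(3)[OF \<psi>(1) x] subgrpD(1)[OF gC] in \<open>simp add: y_def n'\<close>)
  qed
  then show "lower sc C act n \<subseteq> face_sums (face_act act) C n"
    unfolding lower_def by (rule span_minimal[OF _ sub])
  show "face_sums (face_act act) C n \<subseteq> lower sc C act n"
  proof
    fix x assume "x \<in> face_sums (face_act act) C n"
    then obtain y where y: "\<forall>j<n. y j \<in> C (n - 1)"
      and x: "x = (\<Sum>j<n. face_act act (n - 1) j (y j))"
      unfolding face_sums_def by blast
    show "x \<in> lower sc C act n"
      unfolding x lower_def
    proof (intro span_sum span_base)
      fix j assume j: "j \<in> {..<n}"
      show "face_act act (n - 1) j (y j) \<in> ?G"
      proof (rule UN_I[of "n - 1"], use j in simp, rule UN_I[of "face (n - 1) j"])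
        show "face (n - 1) j \<in> (Hom (n - 1) n :: ((nat \<Rightarrow> nat) \<times> (nat \<Rightarrow> 'g)) set)"
          using face_Hom[of "n - 1" j] j by simp
        show "face_act act (n - 1) j (y j) \<in> act (n - 1) n (face (n - 1) j) ` C (n - 1)"
          using y j by (simp add: face_act_def)
      qed
    qed
  qed
qed

section \<open>Free modules are acyclic\<close>

lemma additive_on_sum:
  assumes "subgrp A" "additive_on A f" "\<And>a. a \<in> t \<Longrightarrow> g a \<in> A"
  shows "f (sum g t) = (\<Sum>a\<in>t. f (g a))"
  using assms(3)
proof (induction t rule: infinite_finite_induct)
  case (insert a t)
  then have "sum g t \<in> A" using subgrp_sum[OF assms(1)] by blast
  then show ?case using insert additive_onD(2)[OF assms(1,2)] by simp
qed (use additive_onD(1)[OF assms(1,2)] in auto)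

context module
begin

text \<open>The maps of an FI_G-module are linear only on the carrier of their source degree, so
  linearity is assumed just on \<open>C\<close>.\<close>

lemma span_image_on:
  assumes C: "subspace C" and S: "S \<subseteq> C" and f: "additive_on C f"
    and sc: "\<And>c x. x \<in> C \<Longrightarrow> f (scale c x) = scale c (f x)"
  shows "f ` span S = span (f ` S)"
proof
  have g: "subgrp C" using subspace_subgrp[OF module_axioms C] .
  have SC: "span S \<subseteq> C" by (rule span_minimal[OF S C])
  show "f ` span S \<subseteq> span (f ` S)"
  proof safe
    fix x assume "x \<in> span S"
    then obtain t r where t: "t \<subseteq> S" and x: "x = (\<Sum>a\<in>t. scale (r a) a)"
      unfolding span_explicit by blast
    have "f x = (\<Sum>a\<in>t. f (scale (r a) a))"
      unfolding x using t S subspace_scale[OF C] by (intro additive_on_sum[OF g f]) blast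
    also have "\<dots> = (\<Sum>a\<in>t. scale (r a) (f a))"
      using t S sc by (intro sum.cong) auto
    also have "\<dots> \<in> span (f ` S)"
      using t by (intro span_sum span_scale span_base) blast
    finally show "f x \<in> span (f ` S)" .
  qed
  have "subspace (f ` span S)"
  proof (rule subspaceI)
    show "0 \<in> f ` span S" using additive_onD(1)[OF g f] span_zero by (metis imageI)
  next
    fix x y assume "x \<in> f ` span S" "y \<in> f ` span S"
    then obtain u v where uv: "u \<in> span S" "v \<in> span S" "x = f u" "y = f v" by blast
    have "u \<in> C" "v \<in> C" using uv SC by blast+
    then have "x + y = f (u + v)" using additive_onD(2)[OF g f] uv by metis
    then show "x + y \<in> f ` span S" using span_add[OF uv(1,2)] by blast
  next
    fix c x assume "x \<in> f ` span S"
    then obtain u where u: "u \<in> span S" "x = f u" by blast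
    then have "u \<in> C" using SC by blast
    then have "scale c x = f (scale c u)" using sc u by metis
    then show "scale c x \<in> f ` span S" using span_scale[OF u(1)] by blast
  qed
  then show "span (f ` S) \<subseteq> f ` span S"
    by (intro span_minimal image_mono span_superset)
qed

lemma span_Int_disjoint:
  assumes U: "independent U" and "X \<subseteq> U" "Y \<subseteq> U" "X \<inter> Y = {}" "v \<in> span X" "v \<in> span Y"
  shows "v = 0"
proof -
  obtain f where f: "v = (\<Sum>x | f x \<noteq> 0. scale (f x) x)" "{x. f x \<noteq> 0} \<subseteq> X" "finite {x. f x \<noteq> 0}"
    using assms(5) unfolding span_alt by blast
  obtain g where g: "v = (\<Sum>x | g x \<noteq> 0. scale (g x) x)" "{x. g x \<noteq> 0} \<subseteq> Y" "finite {x. g x \<noteq> 0}"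
    using assms(6) unfolding span_alt by blast
  have "f = g"
    using f g assms(2,3) by (intro unique_representation[OF U]) auto
  then have "{x. f x \<noteq> 0} = {}" using f(2) g(2) assms(4) by blast
  then show ?thesis unfolding f(1) by simp
qed

lemma span_eq_0_if_image_independent:
  assumes C: "subspace C" and S: "S \<subseteq> C" and f: "additive_on C f"
    and sc: "\<And>c x. x \<in> C \<Longrightarrow> f (scale c x) = scale c (f x)"
    and inj: "inj_on f S" and ind: "independent (f ` S)" and z: "z \<in> span S" "f z = 0"
  shows "z = 0"
proof -
  have g: "subgrp C" using subspace_subgrp[OF module_axioms C] .
  obtain t r where t: "finite t" "t \<subseteq> S" and x: "z = (\<Sum>a\<in>t. scale (r a) a)"
    using z(1) unfolding span_explicit by blast
  have injt: "inj_on f t" using inj t(2) inj_on_subset by blast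
  have "f z = (\<Sum>a\<in>t. f (scale (r a) a))"
    unfolding x using t S subspace_scale[OF C] by (intro additive_on_sum[OF g f]) blast
  also have "\<dots> = (\<Sum>a\<in>t. scale (r (inv_into t f (f a))) (f a))"
    using t S sc inv_into_f_f[OF injt] by (intro sum.cong) auto
  also have "\<dots> = (\<Sum>b\<in>f ` t. scale (r (inv_into t f b)) b)"
    by (simp add: sum.reindex[OF injt])
  finally have 0: "(\<Sum>b\<in>f ` t. scale (r (inv_into t f b)) b) = 0" using z(2) by simp
  have "r a = 0" if "a \<in> t" for a
    using independentD[OF ind finite_imageI[OF t(1)] image_mono[OF t(2)] 0, of "f a"] that inv_into_f_f[OF injt that]
    by simp
  then show ?thesis unfolding x by simp
qed

end

locale fig_basis =
  fixes sc :: "'k::comm_ring_1 \<Rightarrow> 'v::ab_group_add \<Rightarrow> 'v"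
    and C :: "nat \<Rightarrow> 'v set"
    and act :: "nat \<Rightarrow> nat \<Rightarrow> (nat \<Rightarrow> nat) \<times> (nat \<Rightarrow> 'g::group_add) \<Rightarrow> 'v \<Rightarrow> 'v"
    and B :: "'v set" and deg :: "'v \<Rightarrow> nat"
  assumes fig: "fig_module sc C act"
    and B_C: "b \<in> B \<Longrightarrow> b \<in> C (deg b)"
    and basis: "inj_on (\<lambda>(b, \<phi>). act (deg b) m \<phi> b) {(b, \<phi>). b \<in> B \<and> \<phi> \<in> Hom (deg b) m}"
      "module.independent sc ((\<lambda>(b, \<phi>). act (deg b) m \<phi> b) ` {(b, \<phi>). b \<in> B \<and> \<phi> \<in> Hom (deg b) m})"
      "module.span sc ((\<lambda>(b, \<phi>). act (deg b) m \<phi> b) ` {(b, \<phi>). b \<in> B \<and> \<phi> \<in> Hom (deg b) m}) = C m"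
begin

sublocale module sc by (rule fig_moduleD(1)[OF fig])

lemmas F = fig_moduleD(2-)[OF fig]

text \<open>Indices (generator, morphism) of the basis of \<open>C m\<close>. Faces act on indices
  by postcomposition (\<open>ins\<close>), and \<open>img\<close> records which points a morphism
  hits; this turns the derivatives of a free module into combinatorics of subsets.\<close>

definition "gen m = {(b, \<phi>::(nat \<Rightarrow> nat) \<times> (nat \<Rightarrow> 'g)). b \<in> B \<and> \<phi> \<in> Hom (deg b) m}"
definition "elt m p = act (deg (fst p)) m (snd p) (fst p)"
definition "ins m j p = (fst p, hom_comp (deg (fst p)) (face m j) (snd p))"
definition "img (p :: 'v \<times> (nat \<Rightarrow> nat) \<times> (nat \<Rightarrow> 'g)) = fst (snd p) ` {1..deg (fst p)}"

text \<open>The \<open>a\<close>-th derivative of a free module is the quotient by the basis elements that miss one of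
  the last \<open>a\<close> positions; its basis consists of the remaining ones.\<close>
definition "miss a m = {p \<in> gen (m + a). \<exists>q. m \<le> q \<and> q < m + a \<and> Suc q \<notin> img p}"
definition "msub a m = span (elt (m + a) ` miss a m)"

lemma basis': "inj_on (elt m) (gen m)" "independent (elt m ` gen m)" "span (elt m ` gen m) = C m"
proof -
  have e: "elt m = (\<lambda>(b, \<phi>). act (deg b) m \<phi> b)" by (simp add: elt_def fun_eq_iff)
  show "inj_on (elt m) (gen m)" "independent (elt m ` gen m)" "span (elt m ` gen m) = C m"
    unfolding e gen_def by (rule basis)+
qed

lemma gen_iff: "p \<in> gen m \<longleftrightarrow> fst p \<in> B \<and> snd p \<in> Hom (deg (fst p)) m"
  by (simp add: gen_def case_prod_beta)

lemma elt_C: "p \<in> gen m \<Longrightarrow> elt m p \<in> C m"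
  using span_base[of "elt m p" "elt m ` gen m"] unfolding basis'(3) by simp

lemma ins_gen: "p \<in> gen m \<Longrightarrow> ins m j p \<in> gen (Suc m)"
  unfolding gen_iff ins_def fst_conv snd_conv using hom_comp_Hom face_Hom by blast

lemma elt_ins: "p \<in> gen m \<Longrightarrow> elt (Suc m) (ins m j p) = face_act act m j (elt m p)"
  unfolding elt_def ins_def face_act_def gen_iff fst_conv snd_conv using F(5)[OF _ face_Hom B_C] by blast

lemma img_ins:
  assumes "p \<in> gen m"
  shows "img (ins m j p) = (\<lambda>y. if y \<le> j then y else Suc y) ` img p"
proof -
  have "snd p \<in> Hom (deg (fst p)) m" using assms unfolding gen_iff by blast
  note HomD(1)[OF this]
  then show ?thesis
    unfolding img_def ins_def image_image by (intro image_cong) (auto simp: hom_comp_def face_def)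
qed

lemma Suc_img_ins: "p \<in> gen m \<Longrightarrow> j \<le> q \<Longrightarrow> Suc (Suc q) \<in> img (ins m j p) \<longleftrightarrow> Suc q \<in> img p"
  unfolding img_ins image_iff by (intro iffI bexI[of _ "Suc q"]) (auto split: if_splits)

lemma ins_image:
  assumes "j \<le> m"
  shows "ins m j ` gen m = {p \<in> gen (Suc m). Suc j \<notin> img p}"
proof (intro equalityI subsetI)
  fix p' assume "p' \<in> ins m j ` gen m"
  then obtain p where p: "p \<in> gen m" "p' = ins m j p" by blast
  have "Suc j \<notin> img p'" unfolding p(2) img_ins[OF p(1)] by (auto split: if_splits)
  then show "p' \<in> {p \<in> gen (Suc m). Suc j \<notin> img p}" using ins_gen[OF p(1)] p(2) by blast
next
  fix p' assume p': "p' \<in> {p \<in> gen (Suc m). Suc j \<notin> img p}"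
  obtain b \<phi> where b: "p' = (b, \<phi>)" by (cases p')
  have "\<phi> \<in> Hom (deg b) (Suc m)" "Suc j \<notin> fst \<phi> ` {1..deg b}"
    using p' unfolding b gen_iff img_def by simp_all
  then obtain \<psi> where \<psi>: "\<psi> \<in> Hom (deg b) m" "hom_comp (deg b) (face m j) \<psi> = \<phi>"
    using Hom_factor[OF _ assms] by metis
  then have "p' = ins m j (b, \<psi>)" "(b, \<psi>) \<in> gen m"
    using p' unfolding b ins_def gen_iff by simp_all
  then show "p' \<in> ins m j ` gen m" by blast
qed

lemma face_linear:
  "additive_on (C m) (face_act act m j)"
  "x \<in> C m \<Longrightarrow> face_act act m j (sc c x) = sc c (face_act act m j x)"
  unfolding face_act_def using F(3,4)[OF face_Hom] by blast+

lemma ins_inj: "inj_on (ins m j) (gen m)"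
proof (rule inj_onI)
  fix p p' assume p: "p \<in> gen m" "p' \<in> gen m" and eq: "ins m j p = ins m j p'"
  obtain b \<phi> b' \<phi>' where pp: "p = (b, \<phi>)" "p' = (b', \<phi>')" by (cases p; cases p') auto
  have b: "b' = b" using eq unfolding pp ins_def by simp
  have h: "hom_comp (deg b) (face m j) \<phi> = hom_comp (deg b) (face m j) \<phi>'"
    using eq unfolding pp ins_def b by simp
  have H: "\<phi> \<in> Hom (deg b) m" "\<phi>' \<in> Hom (deg b) m" using p unfolding pp b gen_iff by simp_all
  have "fst \<phi> x = fst \<phi>' x \<and> snd \<phi> x = snd \<phi>' x" for x
  proof (cases "x \<in> {1..deg b}")
    case True
    then show ?thesis
      using fun_cong[OF arg_cong[OF h, of fst], of x] fun_cong[OF arg_cong[OF h, of snd], of x]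
        HomD(1)[OF H(1) True] HomD(1)[OF H(2) True]
      by (auto simp: hom_comp_def face_def split: if_splits)
  next
    case False
    then show ?thesis using HomD(2,3)[OF H(1) False] HomD(2,3)[OF H(2) False] by simp
  qed
  then show "p = p'" unfolding pp b by (simp add: prod_eq_iff fun_eq_iff)
qed

text \<open>In the \<open>a\<close>-fold shift the last face inserts a point just before the
  \<open>a\<close> added ones. Missing one of the last \<open>a + 1\<close> points means missing one
  of the last \<open>a\<close>, or missing that inserted point and so coming from the last
  face.\<close>

lemma miss_Suc: "miss (Suc a) m = miss a (Suc m) \<union> ins (m + a) m ` gen (m + a)"
proof (rule set_eqI)
  fix p
  let ?P = "\<lambda>q. Suc q \<notin> img p"
  have "(\<exists>q. m \<le> q \<and> q < m + Suc a \<and> ?P q) \<longleftrightarrow> (\<exists>q. Suc m \<le> q \<and> q < Suc m + a \<and> ?P q) \<or> ?P m"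
  proof (intro iffI)
    assume "\<exists>q. m \<le> q \<and> q < m + Suc a \<and> ?P q"
    then obtain q where q: "m \<le> q" "q < m + Suc a" "?P q" by blast
    show "(\<exists>q. Suc m \<le> q \<and> q < Suc m + a \<and> ?P q) \<or> ?P m"
    proof (cases "q = m")
      case False
      then have "Suc m \<le> q \<and> q < Suc m + a \<and> ?P q" using q by simp
      then show ?thesis by blast
    qed (use q in simp)
  next
    assume "(\<exists>q. Suc m \<le> q \<and> q < Suc m + a \<and> ?P q) \<or> ?P m"
    then show "\<exists>q. m \<le> q \<and> q < m + Suc a \<and> ?P q"
    proof
      assume "\<exists>q. Suc m \<le> q \<and> q < Suc m + a \<and> ?P q"
      then obtain q where "Suc m \<le> q" "q < Suc m + a" "?P q" by blast
      then show ?thesis by (intro exI[of _ q]) simp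
    next
      assume "?P m"
      then show ?thesis by (intro exI[of _ m]) simp
    qed
  qed
  then show "p \<in> miss (Suc a) m \<longleftrightarrow> p \<in> miss a (Suc m) \<union> ins (m + a) m ` gen (m + a)"
    unfolding ins_image[OF le_add1] Un_iff miss_def mem_Collect_eq add_Suc add_Suc_right by blast
qed

text \<open>Inserting position \<open>m\<close> moves the positions from \<open>m\<close> on up by
  one, so a missed point among the last \<open>a\<close> is neither created nor lost.\<close>

lemma ins_miss:
  assumes p: "p \<in> gen (m + a)"
  shows "ins (m + a) m p \<in> miss a (Suc m) \<longleftrightarrow> p \<in> miss a m"
proof -
  have "(\<exists>q. Suc m \<le> q \<and> q < Suc m + a \<and> Suc q \<notin> img (ins (m + a) m p)) \<longleftrightarrow>
    (\<exists>q. m \<le> q \<and> q < m + a \<and> Suc q \<notin> img p)"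
  proof safe
    fix q assume q: "Suc m \<le> q" "q < Suc m + a" "Suc q \<notin> img (ins (m + a) m p)"
    then obtain q' where "q = Suc q'" by (cases q) auto
    then show "\<exists>q. m \<le> q \<and> q < m + a \<and> Suc q \<notin> img p"
      using q Suc_img_ins[OF p, of m q'] by (intro exI[of _ q']) simp
  next
    fix q assume q: "m \<le> q" "q < m + a" "Suc q \<notin> img p"
    then show "\<exists>q. Suc m \<le> q \<and> q < Suc m + a \<and> Suc q \<notin> img (ins (m + a) m p)"
      using Suc_img_ins[OF p, of m q] by (intro exI[of _ "Suc q"]) simp
  qed
  then show ?thesis unfolding miss_def using ins_gen[OF p, of m] p by simp
qed

lemma miss_gen: "miss a m \<subseteq> gen (m + a)"
  unfolding miss_def by blast

lemma face_image_span:
  assumes "X \<subseteq> gen m"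
  shows "face_act act m j ` span (elt m ` X) = span (elt (Suc m) ` ins m j ` X)"
proof -
  have "elt m ` X \<subseteq> C m" using assms elt_C by blast
  then have "face_act act m j ` span (elt m ` X) = span (face_act act m j ` elt m ` X)"
    using face_linear by (intro span_image_on[OF F(1)]) auto
  also have "face_act act m j ` elt m ` X = elt (Suc m) ` ins m j ` X"
    unfolding image_image using assms elt_ins by (intro image_cong) auto
  finally show ?thesis .
qed

lemma deriv_msub: "deriv_sub (\<lambda>m. face_act act (m + a)) (\<lambda>m. C (m + a)) (msub a) = msub (Suc a)"
proof
  fix m
  have im: "span (elt (Suc (m + a)) ` ins (m + a) m ` gen (m + a)) = face_act act (m + a) m ` C (m + a)"
    using face_image_span[of "gen (m + a)" "m + a" m] basis'(3) by simp
  show "deriv_sub (\<lambda>m. face_act act (m + a)) (\<lambda>m. C (m + a)) (msub a) m = msub (Suc a) m"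
    unfolding deriv_sub_def msub_def miss_Suc image_Un add_Suc add_Suc_right span_Un last_face_def im by blast
qed

lemma shift_add: "shift (\<lambda>m. X (m + a)) = (\<lambda>m. X (m + Suc a))"
  by (simp add: shift_def fun_eq_iff)

lemma msub_0: "msub 0 m = {0}"
proof -
  have "miss 0 m = {}" unfolding miss_def by auto
  then show ?thesis unfolding msub_def by simp
qed

lemma subquotient_msub: "subquotient (\<lambda>m. face_act act (m + a)) (\<lambda>m. C (m + a)) (msub a)"
proof (induction a)
  case 0
  have fm: "face_module (face_act act) C" by (rule fig_face_module[OF fig])
  have "stable (face_act act) (\<lambda>m. {0})"
    unfolding stable_def subgrp_def using face_module_0[OF fm] by simp
  then show ?case
    using fm subgrpD(1)[OF face_module_subgrp[OF fm]] unfolding subquotient_def msub_0[abs_def] by simp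
next
  case (Suc a)
  show ?case using subquotient_deriv[OF Suc] unfolding shift_add deriv_msub .
qed

text \<open>The last face sends the basis elements outside \<open>miss a m\<close> injectively to
  basis elements outside \<open>miss a (Suc m)\<close>, hence is injective on the quotients.\<close>

lemma ker_msub: "ker_sub (\<lambda>m. face_act act (m + a)) (\<lambda>m. C (m + a)) (msub a) = msub a"
proof
  fix m
  let ?d = "face_act act (m + a) m"
  note S = subquotientD[OF subquotient_msub[of a]]
  note K = subquotient_ker[OF subquotient_msub[of a]]
  have "x \<in> msub a m" if x: "x \<in> C (m + a)" and dx: "?d x \<in> msub a (Suc m)" for x
  proof -
    \<comment> \<open>These indices give a basis of the quotient. Modulo \<open>msub a m\<close> the
      element \<open>x\<close> becomes its component \<open>z\<close> along them, and it is
      \<open>z\<close> that has to vanish.\<close>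
    let ?R = "gen (m + a) - miss a m"
    have "gen (m + a) = miss a m \<union> ?R" using miss_gen by blast
    then have "x \<in> span (elt (m + a) ` miss a m \<union> elt (m + a) ` ?R)"
      using x basis'(3)[of "m + a"] by (metis image_Un)
    then obtain y z where xyz: "x = y + z" and y: "y \<in> msub a m" and z: "z \<in> span (elt (m + a) ` ?R)"
      unfolding span_Un msub_def by blast
    have zC: "z \<in> C (m + a)" using z span_mono[OF image_mono[of ?R "gen (m + a)" "elt (m + a)"]] basis'(3)[of "m + a"] by blast
    have yC: "y \<in> C (m + a)" using y S(3)[of m] by blast
    have "?d y \<in> msub a (Suc m)" using S(7)[OF le_refl y] .
    moreover have "?d z = ?d x - ?d y"
      unfolding xyz using additive_onD(2)[OF subspace_subgrp[OF module_axioms F(1)] face_linear(1) yC zC] by simp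
    ultimately have dz: "?d z \<in> msub a (Suc m)" using subgrpD(2)[OF S(6)] dx by metis
    have "?d z \<in> ?d ` span (elt (m + a) ` ?R)" using z by blast
    then have dz': "?d z \<in> span (elt (Suc (m + a)) ` ins (m + a) m ` ?R)"
      using face_image_span[of ?R "m + a" m] by blast
    have ig: "ins (m + a) m ` ?R \<subseteq> gen (Suc (m + a))" using ins_gen by blast
    have mg: "miss a (Suc m) \<subseteq> gen (Suc (m + a))" using miss_gen[of a "Suc m"] by simp
    have "ins (m + a) m ` ?R \<inter> miss a (Suc m) = {}" using ins_miss by blast
    then have disj: "elt (Suc (m + a)) ` ins (m + a) m ` ?R \<inter> elt (Suc (m + a)) ` miss a (Suc m) = {}"
      using inj_on_image_Int[OF basis'(1) ig mg] by simp
    have "?d z = 0"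
      by (rule span_Int_disjoint[OF basis'(2) image_mono[OF ig] image_mono[OF mg] disj dz'])
        (use dz in \<open>simp add: msub_def\<close>)
    moreover have inj: "inj_on (?d) (elt (m + a) ` ?R)"
    proof -
      have "inj_on (elt (Suc (m + a)) \<circ> ins (m + a) m) ?R"
        using comp_inj_on[OF inj_on_subset[OF ins_inj] inj_on_subset[OF basis'(1) ig]] by blast
      moreover have "inj_on (elt (Suc (m + a)) \<circ> ins (m + a) m) ?R \<longleftrightarrow> inj_on (?d \<circ> elt (m + a)) ?R"
        by (rule inj_on_cong) (simp add: elt_ins)
      ultimately show ?thesis using inj_on_imageI by blast
    qed
    moreover have "independent (?d ` elt (m + a) ` ?R)"
    proof -
      have "?d ` elt (m + a) ` ?R = elt (Suc (m + a)) ` ins (m + a) m ` ?R"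
        unfolding image_image using elt_ins by (intro image_cong) auto
      then show ?thesis using independent_mono[OF basis'(2) image_mono[OF ig]] by simp
    qed
    moreover have "elt (m + a) ` ?R \<subseteq> C (m + a)" using elt_C by blast
    ultimately have "z = 0"
      using span_eq_0_if_image_independent[OF F(1) _ face_linear _ _ z] by blast
    then show ?thesis using y xyz by simp
  qed
  then have "ker_sub (\<lambda>m. face_act act (m + a)) (\<lambda>m. C (m + a)) (msub a) m \<subseteq> msub a m"
    unfolding ker_sub_def last_face_def by auto
  then show "ker_sub (\<lambda>m. face_act act (m + a)) (\<lambda>m. C (m + a)) (msub a) m = msub a m"
    using K(2) by blast
qed

text \<open>All iterated derivatives have zero kernel, so the exact sequence trades one point for
  one more derivative until no points are left. That is why \<open>a\<close> varies in the
  induction.\<close>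

lemma homology_vanishes_msub:
  "1 \<le> p \<Longrightarrow> homology_vanishes (\<lambda>m. face_act act (m + a)) (\<lambda>m. C (m + a)) (msub a) n p"
proof (induction n arbitrary: a)
  case 0
  then show ?case using homology_vanishes_out_of_range[OF subquotient_msub] by simp
next
  case (Suc n)
  show ?case
  proof (rule homology_vanishes_shift_deriv[OF subquotient_msub])
    show "homology_vanishes (\<lambda>m. face_act act (m + a)) (ker_sub (\<lambda>m. face_act act (m + a)) (\<lambda>m. C (m + a)) (msub a)) (msub a) n (p - 1)"
      using homology_vanishes_eq[OF subquotient_ker_sub[OF subquotient_msub]] unfolding ker_msub by blast
    show "homology_vanishes (shift (\<lambda>m. face_act act (m + a))) (shift (\<lambda>m. C (m + a)))
        (deriv_sub (\<lambda>m. face_act act (m + a)) (\<lambda>m. C (m + a)) (msub a)) n p"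
      unfolding shift_add deriv_msub by (rule Suc.IH[OF Suc.prems])
  qed
qed

end

theorem free_fig_acyclic:
  assumes "fig_module sc C act" "free_fig sc C act" "1 \<le> p"
  shows "homology_vanishes (face_act act) C (\<lambda>m. {0}) n p"
proof -
  obtain B deg where B: "\<forall>b\<in>B. b \<in> C (deg b)"
    and basis: "\<forall>m. inj_on (\<lambda>(b, \<phi>). act (deg b) m \<phi> b) {(b, \<phi>). b \<in> B \<and> \<phi> \<in> Hom (deg b) m} \<and>
      module.independent sc ((\<lambda>(b, \<phi>). act (deg b) m \<phi> b) ` {(b, \<phi>). b \<in> B \<and> \<phi> \<in> Hom (deg b) m}) \<and>
      module.span sc ((\<lambda>(b, \<phi>). act (deg b) m \<phi> b) ` {(b, \<phi>). b \<in> B \<and> \<phi> \<in> Hom (deg b) m}) = C m"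
    using assms(2) unfolding free_fig_def by (elim exE conjE) (rule that; assumption)
  interpret fig_basis sc C act B deg
  proof
    show "fig_module sc C act" by (rule assms(1))
    show "b \<in> C (deg b)" if "b \<in> B" for b using B that by (rule bspec)
  qed (use basis in \<open>simp_all only: simp_thms\<close>)
  show ?thesis using homology_vanishes_msub[OF assms(3), of 0 n] unfolding msub_0[abs_def] by simp
qed

section \<open>Free resolutions\<close>

lemma fig_mapD:
  assumes "fig_map sc1 C1 act1 sc2 C2 act2 G"
  shows "x \<in> C1 n \<Longrightarrow> G n x \<in> C2 n" "additive_on (C1 n) (G n)"
    "\<phi> \<in> Hom n m \<Longrightarrow> x \<in> C1 n \<Longrightarrow> G m (act1 n m \<phi> x) = act2 n m \<phi> (G n x)"
  using assms unfolding fig_map_def additive_on_def by blast+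

lemma face_sums_subset: "stable \<delta> A \<Longrightarrow> face_sums \<delta> A n \<subseteq> A n"
proof
  fix x assume A: "stable \<delta> A" and "x \<in> face_sums \<delta> A n"
  then obtain y where y: "\<forall>j<n. y j \<in> A (n - 1)" and x: "x = (\<Sum>j<n. \<delta> (n - 1) j (y j))"
    unfolding face_sums_def by blast
  have "\<delta> (n - 1) j (y j) \<in> A n" if "j < n" for j
    using A y that unfolding stable_def by (cases n) auto
  then show "x \<in> A n" unfolding x using subgrp_sum[OF stable_subgrp[OF A]] by (metis lessThan_iff)
qed

locale fig_morphism =
  fixes sc1 :: "'k::comm_ring_1 \<Rightarrow> 'v::ab_group_add \<Rightarrow> 'v" and C1
    and act1 :: "nat \<Rightarrow> nat \<Rightarrow> (nat \<Rightarrow> nat) \<times> (nat \<Rightarrow> 'g::group_add) \<Rightarrow> 'v \<Rightarrow> 'v"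
    and sc2 :: "'k \<Rightarrow> 'w::ab_group_add \<Rightarrow> 'w" and C2 and act2 and G
  assumes fig1: "fig_module sc1 C1 act1" and fig2: "fig_module sc2 C2 act2"
    and G: "fig_map sc1 C1 act1 sc2 C2 act2 G"
begin

text \<open>The subquotient \<open>C2 / im\<close> is the cokernel of \<open>G\<close>. For a
  differential of the resolution, \<open>im\<close> is a syzygy.\<close>

definition "im n = G n ` C1 n"

lemmas fm1 = fig_face_module[OF fig1] and fm2 = fig_face_module[OF fig2]
lemmas G_add = additive_onD[OF face_module_subgrp[OF fm1] fig_mapD(2)[OF G]]

lemma G_face: "x \<in> C1 m \<Longrightarrow> G (Suc m) (face_act act1 m j x) = face_act act2 m j (G m x)"
  unfolding face_act_def by (rule fig_mapD(3)[OF G face_Hom])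

lemma im_subset: "im n \<subseteq> C2 n"
  unfolding im_def using fig_mapD(1)[OF G] by blast

lemma im_stable: "stable (face_act act2) im"
proof -
  have "subgrp (im m)" for m
    unfolding subgrp_def
  proof (intro conjI ballI)
    show "0 \<in> im m" unfolding im_def using G_add(1) subgrpD(1)[OF face_module_subgrp[OF fm1]] by (metis imageI)
  next
    fix x y assume "x \<in> im m" "y \<in> im m"
    then obtain u v where uv: "u \<in> C1 m" "v \<in> C1 m" "x = G m u" "y = G m v" unfolding im_def by blast
    then have "x - y = G m (u - v)" using G_add(3) by simp
    then show "x - y \<in> im m" unfolding im_def using subgrpD(2)[OF face_module_subgrp[OF fm1] uv(1,2)] by blast
  qed
  moreover have "face_act act2 m j x \<in> im (Suc m)" if j: "j \<le> m" and x: "x \<in> im m" for m j x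
  proof -
    obtain u where u: "u \<in> C1 m" "x = G m u" using x unfolding im_def by blast
    have "face_act act1 m j u \<in> C1 (Suc m)" using fm1 u(1) j unfolding face_module_def stable_def by blast
    then show ?thesis unfolding u(2) G_face[OF u(1), symmetric] im_def by blast
  qed
  ultimately show ?thesis unfolding stable_def by blast
qed

lemma im_swap: "Suc i < m \<Longrightarrow> x \<in> im m \<Longrightarrow> swap_act act2 m i x \<in> im m"
proof -
  assume i: "Suc i < m" and "x \<in> im m"
  then obtain u where u: "u \<in> C1 m" "x = G m u" unfolding im_def by blast
  have "act1 m m (swap m i) u \<in> C1 m" by (rule fig_moduleD(3)[OF fig1 swap_Hom[OF i] u(1)])
  then show ?thesis
    unfolding u(2) swap_act_def fig_mapD(3)[OF G swap_Hom[OF i] u(1), symmetric] im_def by blast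
qed

lemma subquotient_im: "subquotient (face_act act2) C2 im"
  unfolding subquotient_def using fm2 im_stable im_subset by blast

text \<open>\<open>G\<close> commutes with faces, and preimages can be chosen face by face. This
  translates statements on lower degrees of an image into statements on the source.\<close>

lemma face_sums_im: "face_sums (face_act act2) im n = G n ` face_sums (face_act act1) C1 n"
proof -
  have G_sum: "G n (\<Sum>j<n. face_act act1 (n - 1) j (y j)) = (\<Sum>j<n. face_act act2 (n - 1) j (G (n - 1) (y j)))"
    if y: "\<And>j. j < n \<Longrightarrow> y j \<in> C1 (n - 1)" for y
  proof -
    have "face_act act1 (n - 1) j (y j) \<in> C1 n" if "j < n" for j
      using fm1 y[OF that] that unfolding face_module_def stable_def by (cases n) auto
    then have "G n (\<Sum>j<n. face_act act1 (n - 1) j (y j)) = (\<Sum>j<n. G n (face_act act1 (n - 1) j (y j)))"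
      by (intro additive_on_sum[OF face_module_subgrp[OF fm1] fig_mapD(2)[OF G]]) simp
    also have "\<dots> = (\<Sum>j<n. face_act act2 (n - 1) j (G (n - 1) (y j)))"
    proof (intro sum.cong refl)
      fix j assume "j \<in> {..<n}"
      then show "G n (face_act act1 (n - 1) j (y j)) = face_act act2 (n - 1) j (G (n - 1) (y j))"
        using G_face[OF y[of j]] by simp
    qed
    finally show ?thesis .
  qed
  show ?thesis
  proof (intro equalityI subsetI)
    fix x assume "x \<in> face_sums (face_act act2) im n"
    then obtain y where y: "\<forall>j<n. y j \<in> im (n - 1)" and x: "x = (\<Sum>j<n. face_act act2 (n - 1) j (y j))"
      unfolding face_sums_def by blast
    have "\<forall>j. \<exists>u. j < n \<longrightarrow> u \<in> C1 (n - 1) \<and> y j = G (n - 1) u" using y unfolding im_def by blast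
    from choice[OF this] obtain u where u: "\<And>j. j < n \<Longrightarrow> u j \<in> C1 (n - 1) \<and> y j = G (n - 1) (u j)" by blast
    have "x = G n (\<Sum>j<n. face_act act1 (n - 1) j (u j))"
      unfolding x using u by (subst G_sum) (auto intro!: sum.cong)
    moreover have "(\<Sum>j<n. face_act act1 (n - 1) j (u j)) \<in> face_sums (face_act act1) C1 n"
      by (rule face_sumsI[OF refl]) (use u in blast)
    ultimately show "x \<in> G n ` face_sums (face_act act1) C1 n" by blast
  next
    fix x assume "x \<in> G n ` face_sums (face_act act1) C1 n"
    then obtain y where y: "\<forall>j<n. y j \<in> C1 (n - 1)" and x: "x = G n (\<Sum>j<n. face_act act1 (n - 1) j (y j))"
      unfolding face_sums_def by blast
    have "x = (\<Sum>j<n. face_act act2 (n - 1) j (G (n - 1) (y j)))"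
      unfolding x by (rule G_sum) (use y in blast)
    then show "x \<in> face_sums (face_act act2) im n"
      by (rule face_sumsI) (use y in \<open>simp add: im_def\<close>)
  qed
qed

lemma push_chains_im: "c \<in> chains C1 n i \<Longrightarrow> push G c \<in> chains im n i"
  by (rule push_chains[of C1 G im]) (auto simp: im_def G_add(1))

lemma boundary_push_G: "c \<in> chains C1 n i \<Longrightarrow> boundary (face_act act2) (push G c) = push G (boundary (face_act act1) c)"
  using fig_mapD(1,2)[OF G] G_face by (intro boundary_push[OF fm1 fm2])

lemma lift_chains:
  assumes "c \<in> chains im n i"
  obtains e where "e \<in> chains C1 n i" "push G e = c"
proof -
  define inn where "inn l \<longleftrightarrow> length l = n \<and> int (nT l) = i" for l
  have "\<exists>u. inn l \<longrightarrow> u \<in> C1 (nF l) \<and> c l = G (nF l) u" for l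
    using chainsD(1)[OF assms, of l] unfolding im_def inn_def by blast
  then obtain u where u: "\<And>l. inn l \<Longrightarrow> u l \<in> C1 (nF l) \<and> c l = G (nF l) (u l)"
    using choice[of "\<lambda>l u. inn l \<longrightarrow> u \<in> C1 (nF l) \<and> c l = G (nF l) u"] by blast
  define e where "e l = (if inn l then u l else 0)" for l
  have "e \<in> chains C1 n i"
    by (rule chainsI; use u in \<open>auto simp: e_def inn_def\<close>)
  moreover have "push G e = c"
  proof
    fix l show "push G e l = c l"
      using u[of l] chainsD(2)[OF assms, of l] G_add(1) by (cases "inn l") (auto simp: push_def e_def inn_def)
  qed
  ultimately show ?thesis by (rule that)
qed

end

text \<open>With the first homology of \<open>P\<close> zero, the long exact sequence of
  \<open>Z \<subseteq> P\<close> identifies the first homology of \<open>P / Z\<close> with the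
  kernel of the map from \<open>H_0(Z)\<close> to \<open>H_0(P)\<close>.\<close>

lemma homology_1_vanishes_iff:
  assumes sq: "subquotient \<delta> P Z" and acyclic: "homology_vanishes \<delta> P (\<lambda>m. {0}) n 1"
  shows "homology_vanishes \<delta> P Z n 1 \<longleftrightarrow> (\<forall>z\<in>Z n. z \<in> face_sums \<delta> P n \<longrightarrow> z \<in> face_sums \<delta> Z n)"
proof
  note S = subquotientD[OF sq]
  note bP = boundary_chains_1[OF S(1)] and bZ = boundary_chains_1[OF face_module_sub[OF S(1,2,3)]]
  note ZP = chains_mono[of Z P, OF S(3), THEN subsetD]
  {
    assume H: "homology_vanishes \<delta> P Z n 1"
    show "\<forall>z\<in>Z n. z \<in> face_sums \<delta> P n \<longrightarrow> z \<in> face_sums \<delta> Z n"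
    proof (intro ballI impI)
      fix z assume z: "z \<in> Z n" "z \<in> face_sums \<delta> P n"
      obtain e where e: "e \<in> chains P n 1" "boundary \<delta> e = single n z" using bP[of n z] z(2) by blast
      have "boundary \<delta> e \<in> chains Z n (1 - 1)" using z(1) e(2) by (simp add: single_in_chains)
      then obtain e' where e': "e' \<in> chains P n (1 + 1)" "e - boundary \<delta> e' \<in> chains Z n 1"
        using homology_vanishesD[OF H e(1)] by blast
      have be: "boundary \<delta> e' \<in> chains P n 1" using boundary_mem_chains[OF S(1,4) e'(1)] by simp
      have "boundary \<delta> (e - boundary \<delta> e') = single n z"
        unfolding boundary_diff[OF S(1) e(1) be] boundary_boundary[OF S(1) e'(1)] e(2) by (rule diff_zero)
      then show "z \<in> face_sums \<delta> Z n" using bZ[of n z] e'(2) by blast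
    qed
  next
    assume A: "\<forall>z\<in>Z n. z \<in> face_sums \<delta> P n \<longrightarrow> z \<in> face_sums \<delta> Z n"
    show "homology_vanishes \<delta> P Z n 1"
      unfolding homology_vanishes_def
    proof (intro ballI impI)
      fix x assume x: "x \<in> chains P n 1" and "boundary \<delta> x \<in> chains Z n (1 - 1)"
      then have bx: "boundary \<delta> x \<in> chains Z n 0" by simp
      define z where "z = boundary \<delta> x (replicate n False)"
      have xz: "boundary \<delta> x = single n z" unfolding z_def by (rule chains_0_single[OF bx])
      have "z \<in> Z n" using bx unfolding xz single_in_chains .
      moreover have "z \<in> face_sums \<delta> P n" using bP[of n z] x xz by blast
      ultimately obtain y where y: "y \<in> chains Z n 1" "boundary \<delta> y = single n z"
        using A bZ[of n z] by blast
      \<comment> \<open>\<open>x\<close> and \<open>y\<close> have the same boundary, so their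
        difference is a genuine cycle of \<open>P\<close> and acyclicity applies.\<close>
      have xy: "x - y \<in> chains P n 1" using subgrpD(2)[OF chains_subgrp[of P, OF S(5)] x ZP[OF y(1)]] .
      have "boundary \<delta> (x - y) = 0"
        unfolding boundary_diff[OF S(1) x ZP[OF y(1)]] xz y(2) by (rule diff_self)
      moreover have "0 \<in> chains (\<lambda>m. {0::'a}) n (1 - 1)" by (rule chainsI) auto
      ultimately obtain e where e: "e \<in> chains P n (1 + 1)" "x - y - boundary \<delta> e \<in> chains (\<lambda>m. {0}) n 1"
        using homology_vanishesD[OF acyclic xy] by metis
      have "(x - y - boundary \<delta> e) l = 0" for l
        using chainsD[OF e(2), of l] by blast
      then have "x - y - boundary \<delta> e = 0" by (intro ext) (metis zero_fun_apply)
      then have "x - boundary \<delta> e = y" by (metis add_diff_cancel_left' diff_add_cancel diff_right_commute eq_iff_diff_eq_0)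
      then show "\<exists>e\<in>chains P n (1 + 1). x - boundary \<delta> e \<in> chains Z n 1" using e(1) y(1) by metis
    qed
  }
qed

section \<open>Comparison with the resolution and dimension shifting\<close>

locale fig_resolution =
  fixes sc :: "'k::comm_ring_1 \<Rightarrow> 'v::ab_group_add \<Rightarrow> 'v"
    and C :: "nat \<Rightarrow> 'v set"
    and act :: "nat \<Rightarrow> nat \<Rightarrow> (nat \<Rightarrow> nat) \<times> (nat \<Rightarrow> 'g::group_add) \<Rightarrow> 'v \<Rightarrow> 'v"
    and scP :: "'k \<Rightarrow> 'p::ab_group_add \<Rightarrow> 'p"
    and PC :: "nat \<Rightarrow> nat \<Rightarrow> 'p set"
    and Pact :: "nat \<Rightarrow> nat \<Rightarrow> nat \<Rightarrow> (nat \<Rightarrow> nat) \<times> (nat \<Rightarrow> 'g) \<Rightarrow> 'p \<Rightarrow> 'p"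
    and dP :: "nat \<Rightarrow> nat \<Rightarrow> 'p \<Rightarrow> 'p"
    and eps :: "nat \<Rightarrow> 'p \<Rightarrow> 'v"
  assumes fig: "fig_module sc C act"
    and res: "free_resolution sc C act scP PC Pact dP eps"
begin

lemma resD:
  shows figP: "fig_module scP (PC j) (Pact j)" and freeP: "free_fig scP (PC j) (Pact j)"
    and eps: "fig_map scP (PC 0) (Pact 0) sc C act eps"
    and dP: "fig_map scP (PC (Suc j)) (Pact (Suc j)) scP (PC j) (Pact j) (dP (Suc j))"
    and eps_surj: "eps n ` PC 0 n = C n"
    and ker_eps: "{x \<in> PC 0 n. eps n x = 0} = dP 1 n ` PC 1 n"
    and ker_dP: "{x \<in> PC (Suc j) n. dP (Suc j) n x = 0} = dP (Suc (Suc j)) n ` PC (Suc (Suc j)) n"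
proof -
  note R = res[unfolded free_resolution_def]
  show "fig_module scP (PC j) (Pact j)" "free_fig scP (PC j) (Pact j)"
    "fig_map scP (PC 0) (Pact 0) sc C act eps"
    "fig_map scP (PC (Suc j)) (Pact (Suc j)) scP (PC j) (Pact j) (dP (Suc j))"
    "eps n ` PC 0 n = C n"
    "{x \<in> PC 0 n. eps n x = 0} = dP 1 n ` PC 1 n"
    using R by - (elim conjE allE[of _ j] allE[of _ n], assumption)+
  show "{x \<in> PC (Suc j) n. dP (Suc j) n x = 0} = dP (Suc (Suc j)) n ` PC (Suc (Suc j)) n"
    using R by (elim conjE) (elim allE, assumption)
qed

sublocale d: fig_morphism scP "PC (Suc j)" "Pact (Suc j)" scP "PC j" "Pact j" "dP (Suc j)" for j
  by (rule fig_morphism.intro[OF figP figP dP])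

sublocale e: fig_morphism scP "PC 0" "Pact 0" sc C act eps
  by (rule fig_morphism.intro[OF figP fig eps])

text \<open>The syzygy inside P_j. By exactness P_j modulo \<open>syz j\<close> is \<open>V\<close>
  for \<open>j = 0\<close> and is isomorphic to \<open>syz (j - 1)\<close> otherwise.\<close>

abbreviation "syz j \<equiv> d.im j"

lemma mem_syz: "x \<in> PC (Suc j) n \<Longrightarrow> dP (Suc j) n x \<in> syz j n"
  unfolding d.im_def by blast

lemma syz_0: "syz 0 n = {x \<in> PC 0 n. eps n x = 0}"
  unfolding ker_eps d.im_def by simp

lemma syz_Suc: "syz (Suc j) n = {x \<in> PC (Suc j) n. dP (Suc j) n x = 0}"
  unfolding ker_dP d.im_def by simp

lemma acyclicP: "1 \<le> i \<Longrightarrow> homology_vanishes (face_act (Pact j)) (PC j) (\<lambda>m. {0}) n i"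
  by (rule free_fig_acyclic[OF figP freeP])

text \<open>Both sides say that \<open>H_0(syz j)\<close> injects into \<open>H_0(P_j)\<close> in
  degree \<open>n\<close>: on the left because P_{j+1} covers \<open>syz j\<close> with kernel the
  next syzygy, on the right by the description of first homology above.\<close>

lemma H_vanishes_iff:
  "H_vanishes scP PC Pact dP (Suc j) n \<longleftrightarrow> homology_vanishes (face_act (Pact j)) (PC j) (syz j) n 1"
  unfolding homology_1_vanishes_iff[OF d.subquotient_im acyclicP[OF order_refl]]
proof
  have fsub: "face_sums (face_act (Pact (Suc j))) (PC (Suc j)) n \<subseteq> PC (Suc j) n"
    by (rule face_sums_subset[OF face_module_stable[OF d.fm1]])
  note L = fig_lower_eq[OF figP]
  {
    assume H: "H_vanishes scP PC Pact dP (Suc j) n"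
    show "\<forall>z\<in>syz j n. z \<in> face_sums (face_act (Pact j)) (PC j) n \<longrightarrow> z \<in> face_sums (face_act (Pact j)) (syz j) n"
    proof (intro ballI impI)
      fix z assume "z \<in> syz j n" and zl: "z \<in> face_sums (face_act (Pact j)) (PC j) n"
      then obtain x where x: "x \<in> PC (Suc j) n" "z = dP (Suc j) n x" unfolding d.im_def by blast
      have "\<exists>y\<in>PC (Suc (Suc j)) n. x - dP (Suc (Suc j)) n y \<in> lower scP (PC (Suc j)) (Pact (Suc j)) n"
        using H x zl unfolding H_vanishes_def L by simp
      then obtain y where y: "y \<in> PC (Suc (Suc j)) n"
        and xy: "x - dP (Suc (Suc j)) n y \<in> face_sums (face_act (Pact (Suc j))) (PC (Suc j)) n"
        unfolding L by blast
      have dy: "dP (Suc (Suc j)) n y \<in> PC (Suc j) n" "dP (Suc j) n (dP (Suc (Suc j)) n y) = 0"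
        using mem_syz[OF y] unfolding syz_Suc by blast+
      have "dP (Suc j) n (x - dP (Suc (Suc j)) n y) = z"
        unfolding d.G_add(3)[OF x(1) dy(1)] dy(2) x(2) by (rule diff_zero)
      then show "z \<in> face_sums (face_act (Pact j)) (syz j) n"
        unfolding d.face_sums_im using xy by blast
    qed
  next
    assume A: "\<forall>z\<in>syz j n. z \<in> face_sums (face_act (Pact j)) (PC j) n \<longrightarrow> z \<in> face_sums (face_act (Pact j)) (syz j) n"
    have "\<exists>y\<in>PC (Suc (Suc j)) n. x - dP (Suc (Suc j)) n y \<in> face_sums (face_act (Pact (Suc j))) (PC (Suc j)) n"
      if x: "x \<in> PC (Suc j) n" "dP (Suc j) n x \<in> face_sums (face_act (Pact j)) (PC j) n" for x
    proof -
      have "dP (Suc j) n x \<in> face_sums (face_act (Pact j)) (syz j) n"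
        using A mem_syz[OF x(1)] x(2) by blast
      then obtain u where u: "u \<in> face_sums (face_act (Pact (Suc j))) (PC (Suc j)) n" "dP (Suc j) n x = dP (Suc j) n u"
        unfolding d.face_sums_im by blast
      have uP: "u \<in> PC (Suc j) n" using u(1) fsub by blast
      have "x - u \<in> PC (Suc j) n" by (rule subgrpD(2)[OF face_module_subgrp[OF d.fm1] x(1) uP])
      moreover have "dP (Suc j) n (x - u) = 0"
        unfolding d.G_add(3)[OF x(1) uP] u(2) by (rule diff_self)
      ultimately have "x - u \<in> syz (Suc j) n" unfolding syz_Suc by blast
      then obtain y where y: "y \<in> PC (Suc (Suc j)) n" "x - u = dP (Suc (Suc j)) n y" unfolding d.im_def by blast
      have "x - dP (Suc (Suc j)) n y = u" unfolding y(2)[symmetric] by simp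
      then show ?thesis using y(1) u(1) by metis
    qed
    then show "H_vanishes scP PC Pact dP (Suc j) n"
      unfolding H_vanishes_def L by simp
  }
qed

text \<open>The connecting map of \<open>syz j \<subseteq> P_j\<close> with P_j acyclic, where
  \<open>syz j\<close> is presented as P_{j+1} modulo \<open>syz (Suc j)\<close>. Cycles of that
  quotient are pushed into P_j, bounded there, and the bounding chain is lifted back.\<close>

lemma dimension_shift:
  assumes i: "1 \<le> i" and H: "homology_vanishes (face_act (Pact j)) (PC j) (syz j) n (i + 1)"
  shows "homology_vanishes (face_act (Pact (Suc j))) (PC (Suc j)) (syz (Suc j)) n i"
  unfolding homology_vanishes_def
proof (intro ballI impI)
  note S = subquotientD[OF d.subquotient_im[of j]] and S' = subquotientD[OF d.subquotient_im[of "Suc j"]]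
  let ?d = "dP (Suc j)" and ?b = "boundary (face_act (Pact j))" and ?b' = "boundary (face_act (Pact (Suc j)))"
  note gP' = chains_subgrp[of "PC (Suc j)", OF S'(5)]
  note pd = push_diff_add(1)[of "PC (Suc j)" ?d, OF S'(5) fig_mapD(2)[OF dP]]
  have ZP: "c \<in> chains (PC j) n i" if "c \<in> chains (syz j) n i" for c i
    using that chains_mono[of "syz j" "PC j", OF S(3)] by blast
  have zero: "push ?d c = 0" if c: "c \<in> chains (syz (Suc j)) n i" for c i
  proof
    fix l show "push ?d c l = 0 l"
      using chains_value[OF c S'(6), of l] unfolding syz_Suc push_def by simp
  qed
  fix x assume x: "x \<in> chains (PC (Suc j)) n i" and bx: "?b' x \<in> chains (syz (Suc j)) n (i - 1)"
  have dx: "push ?d x \<in> chains (syz j) n i" by (rule d.push_chains_im[OF x])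
  have "?b (push ?d x) = 0" unfolding d.boundary_push_G[OF x] by (rule zero[OF bx])
  moreover have "0 \<in> chains (\<lambda>m. {0::'p}) n (i - 1)" by (rule chainsI) auto
  ultimately obtain w where w: "w \<in> chains (PC j) n (i + 1)" "push ?d x - ?b w \<in> chains (\<lambda>m. {0}) n i"
    using homology_vanishesD[OF acyclicP[OF i] ZP[OF dx]] by metis
  have "(push ?d x - ?b w) l = 0" for l
    using chainsD[OF w(2), of l] by blast
  then have "push ?d x - ?b w = 0" by (intro ext) (metis zero_fun_apply)
  then have xw: "?b w = push ?d x" by (metis eq_iff_diff_eq_0)
  have "?b w \<in> chains (syz j) n (i + 1 - 1)" unfolding xw using dx by simp
  then obtain v where v: "v \<in> chains (PC j) n (i + 1 + 1)" "w - ?b v \<in> chains (syz j) n (i + 1)"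
    using homology_vanishesD[OF H w(1)] by blast
  have bv: "?b v \<in> chains (PC j) n (i + 1)" using boundary_mem_chains[OF S(1,4) v(1)] by (simp add: add.commute)
  have bwv: "?b (w - ?b v) = push ?d x"
    unfolding boundary_diff[OF S(1) w(1) bv] boundary_boundary[OF S(1) v(1)] xw by (rule diff_zero)
  \<comment> \<open>After correction by a boundary, the bounding chain lies in the image of the
    differential and so lifts to P_{j+1}.\<close>
  obtain u where u: "u \<in> chains (PC (Suc j)) n (i + 1)" "push ?d u = w - ?b v"
    using d.lift_chains[OF v(2)] by blast
  have bu: "?b' u \<in> chains (PC (Suc j)) n i" using boundary_mem_chains[OF S'(1,4) u(1)] by simp
  have xu: "x - ?b' u \<in> chains (PC (Suc j)) n i" by (rule subgrpD(2)[OF gP' x bu])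
  have "push ?d (x - ?b' u) = 0"
    unfolding pd[OF x bu] d.boundary_push_G[OF u(1), symmetric] u(2) bwv by (rule diff_self)
  then have "?d (nF l) ((x - ?b' u) l) = 0" for l unfolding push_def by (metis zero_fun_apply)
  then have "x - ?b' u \<in> chains (syz (Suc j)) n i"
    using chainsD[OF xu] by (intro chainsI) (auto simp: syz_Suc)
  then show "\<exists>e\<in>chains (PC (Suc j)) n (i + 1). x - ?b' e \<in> chains (syz (Suc j)) n i"
    using u(1) by blast
qed

lemma dimension_shift_iterate:
  "1 \<le> i \<Longrightarrow> homology_vanishes (face_act (Pact 0)) (PC 0) (syz 0) n (int j + i) \<Longrightarrow>
    homology_vanishes (face_act (Pact j)) (PC j) (syz j) n i"
proof (induction j arbitrary: i)
  case (Suc j)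
  have "int (Suc j) + i = int j + (i + 1)" by simp
  note H = Suc.prems(2)[unfolded this]
  have "homology_vanishes (face_act (Pact j)) (PC j) (syz j) n (i + 1)"
    by (rule Suc.IH[OF _ H]) (use Suc.prems(1) in simp)
  then show ?case by (rule dimension_shift[OF Suc.prems(1)])
qed simp

text \<open>Generators of \<open>V\<close> in lower degree lift along the surjection
  \<open>eps\<close>; the error lies in its kernel, the syzygy.\<close>

lemma homology_0_vanishes_syz:
  assumes "C n \<subseteq> lower sc C act n"
  shows "homology_vanishes (face_act (Pact 0)) (PC 0) (syz 0) n 0"
proof (rule homology_0_vanishes[OF d.subquotient_im])
  have eC: "e.im = C" unfolding e.im_def[abs_def] eps_surj ..
  fix x assume x: "x \<in> PC 0 n"
  then have "eps n x \<in> face_sums (face_act act) e.im n"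
    using assms fig_mapD(1)[OF eps x] unfolding fig_lower_eq[OF fig] eC by blast
  then obtain y where y: "y \<in> face_sums (face_act (Pact 0)) (PC 0) n" "eps n x = eps n y"
    unfolding e.face_sums_im by blast
  have yP: "y \<in> PC 0 n" using y(1) face_sums_subset[OF face_module_stable[OF e.fm1]] by blast
  have "x - y \<in> syz 0 n"
    unfolding syz_0 using subgrpD(2)[OF face_module_subgrp[OF e.fm1] x yP] e.G_add(3)[OF x yP] y(2) by simp
  then show "\<exists>y\<in>face_sums (face_act (Pact 0)) (PC 0) n. x - y \<in> syz 0 n" using y(1) by blast
qed

lemma regularity:
  assumes "generated_in_degree_le sc C act d" "hd_le scP PC Pact dP 1 (int r)" "1 \<le> i"
  shows "hd_le scP PC Pact dP i (int i + int r + int (min r d) - 1)"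
  unfolding hd_le_def
proof (intro allI impI)
  fix n assume n: "int i + int r + int (min r d) - 1 < int n"
  obtain j where j: "i = Suc j" using assms(3) by (cases i) auto
  have sy: "symmetric_structure (swap_act (Pact 0)) (face_act (Pact 0)) (PC 0) (syz 0)"
  proof (rule fig_symmetric[OF figP])
    fix m i x assume "Suc i < m" "x \<in> syz 0 m"
    then show "swap_act (Pact 0) m i x \<in> syz 0 m" by (rule d.im_swap)
  qed
  have "homology_vanishes (face_act (Pact 0)) (PC 0) (syz 0) n (int j + 1)"
  \<comment> \<open>\<open>Suc d\<close> because the parameter there exceeds the degree of
    generation by one.\<close>
  proof (rule regularity_bound[OF d.subquotient_im sy, of "Suc d" r])
    show "homology_vanishes (face_act (Pact 0)) (PC 0) (syz 0) n 0" if "Suc d \<le> n" for n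
      using assms(1) that unfolding generated_in_degree_le_def by (intro homology_0_vanishes_syz) simp
    fix n assume "r < n"
    then have "H_vanishes scP PC Pact dP (Suc 0) n" using assms(2) unfolding hd_le_def by simp
    then show "homology_vanishes (face_act (Pact 0)) (PC 0) (syz 0) n 1"
      unfolding H_vanishes_iff .
  next
    show "int j + 1 + int r + min (int r) (int (Suc d) - 1) - 1 < int n"
      using n unfolding j by simp
  qed simp
  \<comment> \<open>\<open>H_i\<close> is the first Koszul homology of P_j modulo
    \<open>syz j\<close>, and \<open>j\<close> dimension shifts derive its vanishing from that of
    degree \<open>j + 1\<close> for P_0 modulo \<open>syz 0\<close>.\<close>
  then show "H_vanishes scP PC Pact dP i n"
    unfolding j H_vanishes_iff by (rule dimension_shift_iterate[OF order_refl])
qed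

end

theorem theoremA:
  fixes sc :: "'k::comm_ring_1 \<Rightarrow> 'v::ab_group_add \<Rightarrow> 'v"
    and C :: "nat \<Rightarrow> 'v set"
    and act :: "nat \<Rightarrow> nat \<Rightarrow> (nat \<Rightarrow> nat) \<times> (nat \<Rightarrow> 'g::group_add) \<Rightarrow> 'v \<Rightarrow> 'v"
    and scP :: "'k \<Rightarrow> 'p::ab_group_add \<Rightarrow> 'p"
    and PC :: "nat \<Rightarrow> nat \<Rightarrow> 'p set"
    and Pact :: "nat \<Rightarrow> nat \<Rightarrow> nat \<Rightarrow> (nat \<Rightarrow> nat) \<times> (nat \<Rightarrow> 'g) \<Rightarrow> 'p \<Rightarrow> 'p"
    and dP :: "nat \<Rightarrow> nat \<Rightarrow> 'p \<Rightarrow> 'p"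
    and eps :: "nat \<Rightarrow> 'p \<Rightarrow> 'v"
    and d r :: nat
  assumes "fig_module sc C act"
    and "free_resolution sc C act scP PC Pact dP eps"
    and "generated_in_degree_le sc C act d"
    and "hd_le scP PC Pact dP 1 (int r)"
  shows "\<forall>i\<ge>1. hd_le scP PC Pact dP i (int i + int r + int (min r d) - 1)"
proof -
  interpret fig_resolution sc C act scP PC Pact dP eps
    by (rule fig_resolution.intro[OF assms(1,2)])
  show ?thesis by (intro allI impI regularity[OF assms(3,4)])
qed

end
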